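(* Assume that $0\in\sigma_{\rm d}(R)\cup\rho(R)$. Let $T_0>0$ and set $\mathbb{X}:=\{x_0\in\mathcal H : 0\in\mathcal R_{T_0}(x_0)\}$. Furthermore, assume that $x_T\in\mathcal R(0)$, where $x_T\in\mathcal H$ is the (fixed, horizon-independent) terminal state. Then the optimal control problem $$\min_{u\in\mathcal U_T}\int_0^T\operatorname{Re}\langle u(t),y(t)\rangle\,dt,\qquad \dot x(t)=(J-R)x(t)+Bu(t),\quad y(t)=B^*x(t),\quad x(0)=x_0,\ x(T)=x_T,$$ has the state integral turnpike property on $\mathbb X$ with respect to the subspace $\mathcal V=\ker R$. That is, there exist continuous functions $F,\tau:\mathbb X\to[0,\infty)$ such that for all $x_0\in\mathbb X$ and all $T>\tau(x_0)$, each optimal pair $(x^*,u^* )$ of this problem on the horizon $[0,T]$ with $x^*(0)=x_0$ satisfies $$\int_0^T\operatorname{dist}^2(x^*(t),\ker R)\,dt\le F(x_0).$$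
   Context: Setting. $\mathcal H$ is a separable (complex) Hilbert space with scalar product $\langle\cdot,\cdot\rangle$ and norm $\|\cdot\|$. $J$ is a (possibly unbounded) skew-adjoint operator on $\mathcal H$ ($J^*=-J$), and $R$ is a (possibly unbounded) positive semi-definite self-adjoint operator on $\mathcal H$ ($R^*=R\ge 0$). It is assumed that either $J$ is $R$-bounded with $R$-bound smaller than one, or $R$ is $J$-bounded with $J$-bound smaller than one. Then $A:=J-R$, defined on $\operatorname{dom}J\cap\operatorname{dom}R$, generates a $C_0$-semigroup of contractions $(\mathcal T(t))_{t\ge0}$. The operator $B:\mathbb C^m\to\mathcal H$ is linear and bounded. Solutions of $\dot x=Ax+Bu$, $x(0)=x_0$, are understood as mild solutions: $x(t;x_0,u):=\mathcal T(t)x_0+\int_0^t\mathcal T(t-s)Bu(s)\,ds$. Controls. $\mathbb U\subset\mathbb C^m$ is a fixed compact and convex set having the origin in its interior, and for $T>0$, $\mathcal U_T:=\{u\in L^2(0,T;\mathbb C^m): u(t)\in\mathbb U\text{ for a.e. }t\}$. Reachability. For $T>0$ and $x_0\in\mathcal H$, $\mathcal R_T(x_0):=\{x(T;x_0,u):u\in\mathcal U_T\}$; $\mathcal R_0(x_0):=\{x_0\}$; and $\mathcal R(x_0):=\bigcup_{T\ge0}\mathcal R_T(x_0)$. Spectrum. $\rho(R)=\{s\in\mathbb C:(R-s)^{-1}\in L(\mathcal H)\}$ is the resolvent set, $\sigma(R)=\mathbb C\setminus\rho(R)$ is the spectrum, and the discrete spectrum $\sigma_{\rm d}(R)$ is the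 set of all isolated eigenvalues of $R$ (eigenvalues that are isolated points of $\sigma(R)$). Optimal pair. $(x^*,u^* )$ is an optimal pair on $[0,T]$ with initial datum $x_0$ if $u^*\in\mathcal U_T$ minimizes the cost $\int_0^T\operatorname{Re}\langle u(t),B^*x(t;x_0,u)\rangle\,dt$ among all $u\in\mathcal U_T$ with $x(T;x_0,u)=x_T$ (and is itself such a control), and $x^*=x(\cdot\,;x_0,u^* )$. Also, $\operatorname{dist}(z,\mathcal V):=\inf_{v\in\mathcal V}\|z-v\|$. *)

theory Defs
  imports "HOL-Analysis.Analysis"
begin

section \<open>Complex Hilbert spaces\<close>

text \<open>
  The scalar product is linear in the first argument. The underlying real scalar product of
  \<^class>\<open>real_inner\<close> is its real part, so that norm and topology are those of \<^class>\<open>real_inner\<close>;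
  positivity and definiteness of \<open>cinner\<close> follow from those of the real scalar product.
\<close>

class complex_inner = real_inner +
  fixes scaleC :: "complex \<Rightarrow> 'a \<Rightarrow> 'a"  (infixr \<open>*\<^sub>C\<close> 75)
    and cinner :: "'a \<Rightarrow> 'a \<Rightarrow> complex"
  assumes scaleC_add_right: "a *\<^sub>C (x + y) = a *\<^sub>C x + a *\<^sub>C y"
    and scaleC_add_left: "(a + b) *\<^sub>C x = a *\<^sub>C x + b *\<^sub>C x"
    and scaleC_scaleC: "a *\<^sub>C (b *\<^sub>C x) = (a * b) *\<^sub>C x"
    and scaleR_eq_scaleC: "r *\<^sub>R x = complex_of_real r *\<^sub>C x"
    and cinner_commute: "cinner x y = cnj (cinner y x)"
    and cinner_add_left: "cinner (x + y) z = cinner x z + cinner y z"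
    and cinner_scaleC_left: "cinner (a *\<^sub>C x) y = a * cinner x y"
    and inner_eq_Re_cinner: "inner x y = Re (cinner x y)"

class chilbert_space = complex_inner + complete_space
begin

subclass banach ..

end

instantiation complex :: chilbert_space
begin

definition scaleC_complex :: "complex \<Rightarrow> complex \<Rightarrow> complex"
  where "scaleC_complex a x = a * x"

definition cinner_complex :: "complex \<Rightarrow> complex \<Rightarrow> complex"
  where "cinner_complex x y = x * cnj y"

instance
  by standard
    (simp_all add: scaleC_complex_def cinner_complex_def inner_complex_def algebra_simps
      scaleR_conv_of_real)

end

instantiation vec :: (complex_inner, finite) complex_inner
begin

definition scaleC_vec :: "complex \<Rightarrow> 'a ^ 'b \<Rightarrow> 'a ^ 'b"
  where "scaleC_vec a x = (\<chi> i. a *\<^sub>C (x $ i))"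

definition cinner_vec :: "'a ^ 'b \<Rightarrow> 'a ^ 'b \<Rightarrow> complex"
  where "cinner_vec x y = (\<Sum>i\<in>UNIV. cinner (x $ i) (y $ i))"

instance
proof
  fix a b :: complex and r :: real and x y z :: "'a ^ 'b"
  show "a *\<^sub>C (x + y) = a *\<^sub>C x + a *\<^sub>C y"
    by (simp add: scaleC_vec_def vec_eq_iff scaleC_add_right)
  show "(a + b) *\<^sub>C x = a *\<^sub>C x + b *\<^sub>C x"
    by (simp add: scaleC_vec_def vec_eq_iff scaleC_add_left)
  show "a *\<^sub>C (b *\<^sub>C x) = (a * b) *\<^sub>C x"
    by (simp add: scaleC_vec_def vec_eq_iff scaleC_scaleC)
  show "r *\<^sub>R x = complex_of_real r *\<^sub>C x"
    by (simp add: scaleC_vec_def vec_eq_iff scaleR_eq_scaleC)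
  show "cinner x y = cnj (cinner y x)"
    by (simp add: cinner_vec_def cinner_commute[symmetric])
  show "cinner (x + y) z = cinner x z + cinner y z"
    by (simp add: cinner_vec_def cinner_add_left sum.distrib)
  show "cinner (a *\<^sub>C x) y = a * cinner x y"
    by (simp add: cinner_vec_def scaleC_vec_def cinner_scaleC_left sum_distrib_left)
  show "inner x y = Re (cinner x y)"
    by (simp add: cinner_vec_def inner_vec_def inner_eq_Re_cinner)
qed

end

instance vec :: (chilbert_space, finite) chilbert_space ..


section \<open>Bounded and unbounded operators\<close>

definition bounded_clinear :: "('a::complex_inner \<Rightarrow> 'b::complex_inner) \<Rightarrow> bool"
  where "bounded_clinear f \<longleftrightarrow> bounded_linear f \<and> (\<forall>c x. f (c *\<^sub>C x) = c *\<^sub>C f x)"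

definition cadjoint :: "('a::complex_inner \<Rightarrow> 'b::complex_inner) \<Rightarrow> 'b \<Rightarrow> 'a"
  where "cadjoint f = (SOME g. \<forall>x y. cinner (f x) y = cinner x (g y))"

text \<open>
  A possibly unbounded operator is a partial function; its domain is given by \<^const>\<open>dom\<close>, and
  equality of partial functions is equality of operators including their domains.
\<close>

definition linear_operator :: "('a::complex_inner \<rightharpoonup> 'b::complex_inner) \<Rightarrow> bool"
  where "linear_operator A \<longleftrightarrow> A 0 = Some 0 \<and>
    (\<forall>x y a b. A x = Some a \<longrightarrow> A y = Some b \<longrightarrow> A (x + y) = Some (a + b)) \<and>
    (\<forall>c x a. A x = Some a \<longrightarrow> A (c *\<^sub>C x) = Some (c *\<^sub>C a))"

definition densely_defined :: "('a::complex_inner \<rightharpoonup> 'b::complex_inner) \<Rightarrow> bool"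
  where "densely_defined A \<longleftrightarrow> closure (dom A) = UNIV"

text \<open>The vector \<open>z\<close> below is unique whenever \<open>A\<close> is densely defined.\<close>

definition op_adjoint :: "('a::complex_inner \<rightharpoonup> 'b::complex_inner) \<Rightarrow> ('b \<rightharpoonup> 'a)"
  where "op_adjoint A y =
    (if \<exists>z. \<forall>x\<in>dom A. cinner (the (A x)) y = cinner x z
     then Some (THE z. \<forall>x\<in>dom A. cinner (the (A x)) y = cinner x z)
     else None)"

definition op_uminus :: "('a \<rightharpoonup> 'b::complex_inner) \<Rightarrow> ('a \<rightharpoonup> 'b)"
  where "op_uminus A x = map_option uminus (A x)"

definition op_diff :: "('a \<rightharpoonup> 'b::complex_inner) \<Rightarrow> ('a \<rightharpoonup> 'b) \<Rightarrow> ('a \<rightharpoonup> 'b)"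
  where "op_diff A B x =
    (if x \<in> dom A \<inter> dom B then Some (the (A x) - the (B x)) else None)"

definition self_adjoint :: "('a::complex_inner \<rightharpoonup> 'a) \<Rightarrow> bool"
  where "self_adjoint A \<longleftrightarrow> linear_operator A \<and> densely_defined A \<and> op_adjoint A = A"

definition skew_adjoint :: "('a::complex_inner \<rightharpoonup> 'a) \<Rightarrow> bool"
  where "skew_adjoint A \<longleftrightarrow> linear_operator A \<and> densely_defined A \<and> op_adjoint A = op_uminus A"

text \<open>Only used for self-adjoint operators, whose quadratic form is real.\<close>

definition positive_semidefinite :: "('a::complex_inner \<rightharpoonup> 'a) \<Rightarrow> bool"
  where "positive_semidefinite A \<longleftrightarrow> (\<forall>x\<in>dom A. 0 \<le> Re (cinner (the (A x)) x))"

definition op_kernel :: "('a \<rightharpoonup> 'b::complex_inner) \<Rightarrow> 'a set"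
  where "op_kernel A = {x. A x = Some 0}"

definition relative_bounds :: "('a::complex_inner \<rightharpoonup> 'b::complex_inner) \<Rightarrow> ('a \<rightharpoonup> 'b) \<Rightarrow> real set"
  where "relative_bounds A S =
    {b. 0 \<le> b \<and> (\<exists>a\<ge>0. \<forall>x\<in>dom S. norm (the (A x)) \<le> a * norm x + b * norm (the (S x)))}"

definition relatively_bounded :: "('a::complex_inner \<rightharpoonup> 'b::complex_inner) \<Rightarrow> ('a \<rightharpoonup> 'b) \<Rightarrow> bool"
  where "relatively_bounded A S \<longleftrightarrow> dom S \<subseteq> dom A \<and> relative_bounds A S \<noteq> {}"

text \<open>The \<open>S\<close>-bound of \<open>A\<close>.\<close>

definition relative_bound :: "('a::complex_inner \<rightharpoonup> 'b::complex_inner) \<Rightarrow> ('a \<rightharpoonup> 'b) \<Rightarrow> real"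
  where "relative_bound A S = Inf (relative_bounds A S)"


section \<open>Spectrum\<close>

definition resolvent_set :: "('a::complex_inner \<rightharpoonup> 'a) \<Rightarrow> complex set"
  where "resolvent_set A =
    {s. \<exists>G. bounded_clinear G \<and>
          (\<forall>y. G y \<in> dom A \<and> the (A (G y)) - s *\<^sub>C G y = y) \<and>
          (\<forall>x\<in>dom A. G (the (A x) - s *\<^sub>C x) = x)}"

definition op_spectrum :: "('a::complex_inner \<rightharpoonup> 'a) \<Rightarrow> complex set"
  where "op_spectrum A = - resolvent_set A"

definition op_eigenvalue :: "('a::complex_inner \<rightharpoonup> 'a) \<Rightarrow> complex \<Rightarrow> bool"
  where "op_eigenvalue A s \<longleftrightarrow> (\<exists>x. x \<noteq> 0 \<and> A x = Some (s *\<^sub>C x))"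

text \<open>Isolated eigenvalues, without any condition on their multiplicity.\<close>

definition discrete_spectrum :: "('a::complex_inner \<rightharpoonup> 'a) \<Rightarrow> complex set"
  where "discrete_spectrum A = {s. op_eigenvalue A s \<and> s isolated_in op_spectrum A}"


section \<open>Semigroups\<close>

text \<open>Only the values \<open>S t\<close> for \<open>t \<ge> 0\<close> are relevant.\<close>

definition C0_semigroup :: "(real \<Rightarrow> 'a::complex_inner \<Rightarrow> 'a) \<Rightarrow> bool"
  where "C0_semigroup S \<longleftrightarrow>
    (\<forall>t\<ge>0. bounded_clinear (S t)) \<and>
    S 0 = id \<and>
    (\<forall>s\<ge>0. \<forall>t\<ge>0. S (s + t) = S s \<circ> S t) \<and>
    (\<forall>x. ((\<lambda>t. S t x) \<longlongrightarrow> x) (at_right 0))"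

definition generator :: "(real \<Rightarrow> 'a::complex_inner \<Rightarrow> 'a) \<Rightarrow> ('a \<rightharpoonup> 'a)"
  where "generator S x =
    (if \<exists>y. ((\<lambda>h. (S h x - x) /\<^sub>R h) \<longlongrightarrow> y) (at_right 0)
     then Some (Lim (at_right 0) (\<lambda>h. (S h x - x) /\<^sub>R h))
     else None)"


section \<open>The optimal control problem\<close>

text \<open>
  Throughout, \<open>S\<close> is the semigroup, \<open>B\<close> the input operator and \<open>U\<close> the set of control values.
  Elements of \<open>L\<^sup>2\<close> are represented by functions on the real line whose values outside
  the horizon \<open>[0, T]\<close> are irrelevant.
\<close>

definition mild_solution ::
  "(real \<Rightarrow> 'a \<Rightarrow> 'a) \<Rightarrow> ('u::chilbert_space \<Rightarrow> 'a) \<Rightarrow> 'a \<Rightarrow> (real \<Rightarrow> 'u) \<Rightarrow> real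
    \<Rightarrow> 'a::{chilbert_space, second_countable_topology}"
  where "mild_solution S B x0 u t = S t x0 + (LINT s:{0..t}|lebesgue. S (t - s) (B (u s)))"

definition admissible_controls ::
  "'u::{chilbert_space, second_countable_topology} set \<Rightarrow> real \<Rightarrow> (real \<Rightarrow> 'u) set"
  where "admissible_controls U T =
    {u. u \<in> borel_measurable (lebesgue_on {0..T}) \<and>
        integrable (lebesgue_on {0..T}) (\<lambda>t. (norm (u t))\<^sup>2) \<and>
        (AE t in lebesgue_on {0..T}. u t \<in> U)}"

definition reachable_at ::
  "(real \<Rightarrow> 'a::{chilbert_space, second_countable_topology} \<Rightarrow> 'a)
    \<Rightarrow> ('u::{chilbert_space, second_countable_topology} \<Rightarrow> 'a) \<Rightarrow> 'u set \<Rightarrow> real \<Rightarrow> 'a \<Rightarrow> 'a set"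
  where "reachable_at S B U T x0 =
    (if T = 0 then {x0} else (\<lambda>u. mild_solution S B x0 u T) ` admissible_controls U T)"

definition reachable ::
  "(real \<Rightarrow> 'a::{chilbert_space, second_countable_topology} \<Rightarrow> 'a)
    \<Rightarrow> ('u::{chilbert_space, second_countable_topology} \<Rightarrow> 'a) \<Rightarrow> 'u set \<Rightarrow> 'a \<Rightarrow> 'a set"
  where "reachable S B U x0 = (\<Union>T\<in>{0..}. reachable_at S B U T x0)"

definition supplied_energy ::
  "(real \<Rightarrow> 'a::{chilbert_space, second_countable_topology} \<Rightarrow> 'a)
    \<Rightarrow> ('u::{chilbert_space, second_countable_topology} \<Rightarrow> 'a) \<Rightarrow> real \<Rightarrow> 'a \<Rightarrow> (real \<Rightarrow> 'u) \<Rightarrow> real"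
  where "supplied_energy S B T x0 u =
    (LINT t:{0..T}|lebesgue. Re (cinner (u t) (cadjoint B (mild_solution S B x0 u t))))"

definition feasible_controls ::
  "(real \<Rightarrow> 'a::{chilbert_space, second_countable_topology} \<Rightarrow> 'a)
    \<Rightarrow> ('u::{chilbert_space, second_countable_topology} \<Rightarrow> 'a) \<Rightarrow> 'u set \<Rightarrow> 'a
    \<Rightarrow> real \<Rightarrow> 'a \<Rightarrow> (real \<Rightarrow> 'u) set"
  where "feasible_controls S B U xT T x0 =
    {u \<in> admissible_controls U T. mild_solution S B x0 u T = xT}"

definition optimal_pair ::
  "(real \<Rightarrow> 'a::{chilbert_space, second_countable_topology} \<Rightarrow> 'a)
    \<Rightarrow> ('u::{chilbert_space, second_countable_topology} \<Rightarrow> 'a) \<Rightarrow> 'u set \<Rightarrow> 'a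
    \<Rightarrow> real \<Rightarrow> 'a \<Rightarrow> (real \<Rightarrow> 'a) \<Rightarrow> (real \<Rightarrow> 'u) \<Rightarrow> bool"
  where "optimal_pair S B U xT T x0 x u \<longleftrightarrow>
    u \<in> feasible_controls S B U xT T x0 \<and>
    (\<forall>v\<in>feasible_controls S B U xT T x0.
       supplied_energy S B T x0 u \<le> supplied_energy S B T x0 v) \<and>
    (\<forall>t\<in>{0..T}. x t = mild_solution S B x0 u t)"

text \<open>
  Here \<open>opt T x0 x u\<close> expresses that \<open>(x, u)\<close> is an optimal pair on the horizon \<open>[0, T]\<close>
  with initial datum \<open>x0\<close>.
\<close>

definition state_integral_turnpike ::
  "(real \<Rightarrow> 'a \<Rightarrow> (real \<Rightarrow> 'a) \<Rightarrow> (real \<Rightarrow> 'u) \<Rightarrow> bool) \<Rightarrow> 'a::chilbert_space set \<Rightarrow> 'a set \<Rightarrow> bool"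
  where "state_integral_turnpike opt X V \<longleftrightarrow>
    (\<exists>F \<tau> :: 'a \<Rightarrow> real.
       continuous_on X F \<and> continuous_on X \<tau> \<and> (\<forall>x0\<in>X. 0 \<le> F x0 \<and> 0 \<le> \<tau> x0) \<and>
       (\<forall>x0\<in>X. \<forall>T>\<tau> x0. \<forall>x u. opt T x0 x u \<longrightarrow>
          (LINT t:{0..T}|lebesgue. (infdist (x t) V)\<^sup>2) \<le> F x0))"

end

theory Submission
  imports Defs
begin

text \<open>
  The energy balance of a mild solution bounds the dissipated energy by
  \<open>\<parallel>x0\<parallel>\<^sup>2 / 2\<close> plus the supplied energy. Since 0 is not an accumulation point of the spectrum of \<open>R\<close>,
  the dissipation rate \<open>Re \<langle>R x, x\<rangle>\<close> is at least \<open>\<delta> dist\<^sup>2(x, ker R)\<close>. The supplied energy of an optimal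
  control is at most that of the control which steers \<open>x0\<close> to 0 in time \<open>T0\<close>, rests there, and
  finally steers 0 to \<open>xT\<close> in time \<open>T1\<close>; this control vanishes outside a set of measure
  \<open>T0 + T1\<close>, so its cost does not depend on the horizon.

  The range of \<open>B\<close> need not lie in the domain of \<open>J - R\<close>, so no classical solutions are available.
  Instead, the energy inequality is first integrated along the free evolution, where it extends from
  the domain of the generator by density, and is then transferred to mild solutions through the
  right Dini derivative of the energy.
\<close>

section \<open>Spectral gap of a nonnegative symmetric operator\<close>

text \<open>The gap is extracted from resolvents at real points alone. If the interval (0, 2m)
  belongs to the resolvent set of R, then (R - m)^-1 has norm at most 1/m, which reads \<parallel>R
  x\<parallel>^2 \<ge> 2m <R x, x>: the inequality \<lambda>^2 \<ge> 2m \<lambda> on the spectrum,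
  in disguise. Cauchy-Schwarz for the form of R turns it into the wanted bound, but only on vectors
  of the range; reaching all of dom R takes resolvents at small negative points.

  For the dynamics, decay of the free evolution is recorded over short intervals with a constant
  lower bound \<open>r\<close> for the distance to the kernel. Such a bound survives approximation
  of the initial state because the semigroup is contractive. The forcing then acts as a perturbation
  over a step of length h, and every error must be at most a small \<eta> times h, although the
  control is merely measurable in time. The source of this uniformity is compactness: all forcing
  values lie in B(U), on which S h tends to the identity uniformly.\<close>

definition resolvent_at :: "'a::real_normed_vector set \<Rightarrow> ('a \<Rightarrow> 'a) \<Rightarrow> real \<Rightarrow> ('a \<Rightarrow> 'a) \<Rightarrow> bool"
  where "resolvent_at D A s G \<longleftrightarrow> bounded_linear G \<and>
    (\<forall>y. G y \<in> D \<and> A (G y) - s *\<^sub>R G y = y) \<and> (\<forall>x\<in>D. G (A x - s *\<^sub>R x) = x)"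

text \<open>Only the real structure is retained: the quadratic form and all spectral points in play
  are real. The unbounded operator is split into a domain \<open>D\<close> and a total map
  \<open>A\<close> whose values off \<open>D\<close> are ignored.\<close>

locale nonneg_symmetric =
  fixes D :: "'a::real_inner set" and A :: "'a \<Rightarrow> 'a"
  assumes subspace_dom: "subspace D"
    and add: "x \<in> D \<Longrightarrow> y \<in> D \<Longrightarrow> A (x + y) = A x + A y"
    and scaleR: "x \<in> D \<Longrightarrow> A (c *\<^sub>R x) = c *\<^sub>R A x"
    and sym: "x \<in> D \<Longrightarrow> y \<in> D \<Longrightarrow> inner (A x) y = inner x (A y)"
    and nonneg: "x \<in> D \<Longrightarrow> 0 \<le> inner (A x) x"
begin

lemma diff: "x \<in> D \<Longrightarrow> y \<in> D \<Longrightarrow> A (x - y) = A x - A y"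
  using add[of x "(-1) *\<^sub>R y"] scaleR[of y "-1"] subspace_scale[OF subspace_dom, of y "-1"]
  by simp

text \<open>The form \<open>inner (A x) y\<close> may be degenerate. The quadratic in
  \<open>t\<close> is nonnegative, and its minimizer \<open>- q / r\<close> gives the claim when
  \<open>r \<noteq> 0\<close>.\<close>

lemma Cauchy_Schwarz:
  assumes "x \<in> D" "y \<in> D"
  shows "(inner (A x) y)\<^sup>2 \<le> inner (A x) x * inner (A y) y"
proof -
  have quad: "0 \<le> inner (A x) x + 2 * t * inner (A x) y + t\<^sup>2 * inner (A y) y" for t
  proof -
    have D: "t *\<^sub>R y \<in> D" "x + t *\<^sub>R y \<in> D"
      using assms subspace_dom by (auto intro: subspace_add subspace_scale)
    have "inner (A y) x = inner (A x) y"
      using sym[OF assms] by (simp add: inner_commute)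
    then have "inner (A (x + t *\<^sub>R y)) (x + t *\<^sub>R y)
        = inner (A x) x + 2 * t * inner (A x) y + t\<^sup>2 * inner (A y) y"
      using D assms by (simp add: add scaleR inner_simps power2_eq_square algebra_simps)
    then show ?thesis
      using nonneg[OF D(2)] by simp
  qed
  define p q r where "p = inner (A x) x" and "q = inner (A x) y" and "r = inner (A y) y"
  have quad: "0 \<le> p + 2 * t * q + t\<^sup>2 * r" for t
    using quad by (simp add: p_def q_def r_def)
  have r: "0 \<le> r" and p: "0 \<le> p"
    using nonneg assms by (auto simp: r_def p_def)
  have "q\<^sup>2 \<le> p * r"
  proof (cases "r = 0")
    case True
    have "q = 0"
    proof (rule ccontr)
      assume "q \<noteq> 0"
      \<comment> \<open>The quadratic has become affine in \<open>t\<close>; at the chosen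
        \<open>t\<close> its value is \<open>- 1\<close>.\<close>
      then show False
        using quad[of "- (p + 1) / (2 * q)"] True by (simp add: field_simps)
    qed
    with p r show ?thesis
      by simp
  next
    case False
    then have "0 < r"
      using r by simp
    then show ?thesis
      using quad[of "- q / r"] by (simp add: field_simps power2_eq_square)
  qed
  then show ?thesis
    by (simp add: p_def q_def r_def)
qed

text \<open>Substituting y = (A - m) H y gives y - \<mu> H y = (A - m - \<mu>) H y. Hence
  \<open>G\<close> recovers \<open>H y\<close> from this vector with a bounded factor, and the
  triangle inequality recovers \<open>y\<close>.\<close>

lemma resolvent_bounded_below:
  assumes H: "resolvent_at D A m H" and G: "resolvent_at D A (m + \<mu>) G"
  obtains k where "0 < k" "\<And>y. k * norm y \<le> norm (y - \<mu> *\<^sub>R H y)"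
proof
  let ?K = "1 + \<bar>\<mu>\<bar> * onorm G"
  have bG: "bounded_linear G"
    using G by (simp add: resolvent_at_def)
  have pos: "0 < ?K"
    using mult_nonneg_nonneg[OF abs_ge_zero[of \<mu>] onorm_pos_le[OF bG]] by linarith
  then show "0 < 1 / ?K"
    by simp
  fix y
  have y: "H y \<in> D" "A (H y) - m *\<^sub>R H y = y"
    using H by (auto simp: resolvent_at_def)
  then have "A (H y) - (m + \<mu>) *\<^sub>R H y = y - \<mu> *\<^sub>R H y"
    by (simp add: algebra_simps)
  then have Hy: "H y = G (y - \<mu> *\<^sub>R H y)"
    using G y(1) by (metis resolvent_at_def)
  have "norm y \<le> norm (y - \<mu> *\<^sub>R H y) + norm (\<mu> *\<^sub>R H y)"
    by (metis diff_add_cancel norm_triangle_ineq)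
  also have "norm (\<mu> *\<^sub>R H y) \<le> \<bar>\<mu>\<bar> * (onorm G * norm (y - \<mu> *\<^sub>R H y))"
    using onorm[OF bG, of "y - \<mu> *\<^sub>R H y"] Hy by (simp add: mult_left_mono)
  finally show "1 / ?K * norm y \<le> norm (y - \<mu> *\<^sub>R H y)"
    using pos by (simp add: field_simps)
qed

text \<open>
  With \<open>H = (A - m)\<^sup>-\<^sup>1\<close> and \<open>c = \<parallel>H\<parallel>\<close>, the operator \<open>c\<^sup>2 - H\<^sup>2\<close> is not bounded below. Hence
  \<open>m + 1/c\<close> or \<open>m - 1/c\<close> has no resolvent, which forces \<open>c \<le> 1/m\<close>.
\<close>
lemma onorm_resolvent_le:
  assumes m: "0 < m" and res: "\<And>s. 0 < s \<Longrightarrow> s < 2 * m \<Longrightarrow> \<exists>G. resolvent_at D A s G"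
    and H: "resolvent_at D A m H"
  shows "onorm H \<le> 1 / m"
proof (rule ccontr)
  assume "\<not> onorm H \<le> 1 / m"
  define c where "c = onorm H"
  define a where "a = 1 / c"
  have c: "1 / m < c" "0 < c"
    using \<open>\<not> onorm H \<le> 1 / m\<close> divide_pos_pos[OF zero_less_one m]
    unfolding c_def by linarith+
  then have a: "0 < a" "a < m"
    using m by (auto simp: a_def field_simps)
  have bH: "bounded_linear H"
    using H by (simp add: resolvent_at_def)
  have HD: "H y \<in> D" "A (H y) = y + m *\<^sub>R H y" for y
    using H by (auto simp: resolvent_at_def diff_eq_eq)
  have Hsym: "inner (H x) y = inner x (H y)" for x y
  proof -
    have "inner (A (H x)) (H y) = inner (H x) (A (H y))"
      by (rule sym) (rule HD)+
    then show ?thesis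
      by (simp add: HD(2) inner_add_left inner_add_right)
  qed
  obtain G1 where G1: "resolvent_at D A (m + a) G1"
    using res[of "m + a"] a by auto
  obtain G2 where G2: "resolvent_at D A (m + (- a)) G2"
    using res[of "m + (- a)"] a by auto
  obtain k1 where k1: "0 < k1" "\<And>y. k1 * norm y \<le> norm (y - a *\<^sub>R H y)"
    using resolvent_bounded_below[OF H G1] by blast
  obtain k2 where k2: "0 < k2" "\<And>y. k2 * norm y \<le> norm (y - (- a) *\<^sub>R H y)"
    using resolvent_bounded_below[OF H G2] by blast
  define k where "k = k1 * k2"
  have kpos: "0 < k"
    using k1(1) k2(1) by (simp add: k_def)
  have le: "(norm (H y))\<^sup>2 \<le> c\<^sup>2 * ((1 - k\<^sup>2) * (norm y)\<^sup>2)" for y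
  proof -
    \<comment> \<open>The factorization of 1 - a^2 H^2 into (1 - a H) (1 + a H) lets the two lower
      bounds multiply.\<close>
    have "k * norm y \<le> k1 * norm (y + a *\<^sub>R H y)"
      using k2(2)[of y] k1(1) by (simp add: k_def mult.assoc mult_left_mono)
    also have "\<dots> \<le> norm (y + a *\<^sub>R H y - a *\<^sub>R H (y + a *\<^sub>R H y))"
      by (rule k1)
    also have "y + a *\<^sub>R H y - a *\<^sub>R H (y + a *\<^sub>R H y) = y - (a * a) *\<^sub>R H (H y)"
      using bH by (simp add: linear_simps algebra_simps)
    finally have "(k * norm y)\<^sup>2 \<le> (norm (y - (a * a) *\<^sub>R H (H y)))\<^sup>2"
      using kpos by (intro power_mono) auto
    also have "\<dots> = (norm y)\<^sup>2 - 2 * (a * a) * inner y (H (H y)) + (a * a)\<^sup>2 * (norm (H (H y)))\<^sup>2"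
      using dot_norm_neg[of y "(a * a) *\<^sub>R H (H y)"] by (simp add: power_mult_distrib)
    also have "inner y (H (H y)) = (norm (H y))\<^sup>2"
      using Hsym[of y "H y"] by (simp add: power2_norm_eq_inner)
    \<comment> \<open>Since \<open>a * c = 1\<close>, the last term is at most
      \<open>a * a * (norm (H y))\<^sup>2\<close> and absorbs half of the negative middle
      term.\<close>
    also have "(a * a)\<^sup>2 * (norm (H (H y)))\<^sup>2 \<le> (a * a)\<^sup>2 * (c * norm (H y))\<^sup>2"
      using onorm[OF bH, of "H y"] by (intro mult_left_mono power_mono) (auto simp: c_def)
    also have "(a * a)\<^sup>2 * (c * norm (H y))\<^sup>2 = a * a * (norm (H y))\<^sup>2"
      using c by (simp add: a_def power2_eq_square)
    finally have "a * a * (norm (H y))\<^sup>2 \<le> (1 - k\<^sup>2) * (norm y)\<^sup>2"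
      by (simp add: power_mult_distrib algebra_simps)
    then show ?thesis
      using c by (simp add: a_def field_simps power2_eq_square)
  qed
  \<comment> \<open>\<open>max 0\<close> covers \<open>k > 1\<close>. As \<open>q < 1\<close>, the
    bound \<open>c * q\<close> for the norm of \<open>H\<close> falls strictly below
    \<open>c\<close>, which is that norm.\<close>
  define q where "q = sqrt (max 0 (1 - k\<^sup>2))"
  have q: "q < 1" "0 \<le> q" "1 - k\<^sup>2 \<le> q\<^sup>2"
    using kpos by (auto simp: q_def)
  have "norm (H y) \<le> c * q * norm y" for y
  proof (rule power2_le_imp_le)
    have "c\<^sup>2 * ((1 - k\<^sup>2) * (norm y)\<^sup>2) \<le> c\<^sup>2 * (q\<^sup>2 * (norm y)\<^sup>2)"
      using q(3) by (intro mult_left_mono mult_right_mono) auto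
    with le[of y] show "(norm (H y))\<^sup>2 \<le> (c * q * norm y)\<^sup>2"
      by (simp add: power_mult_distrib mult.assoc)
    show "0 \<le> c * q * norm y"
      using c q by simp
  qed
  then have "c \<le> c * q"
    using c q unfolding c_def by (intro onorm_bound) auto
  with c q show False
    by simp
qed

text \<open>The resolvent bound says that \<open>A - m\<close> expands by at least \<open>m\<close>;
  squaring this and cancelling the common term \<open>(m * norm x)\<^sup>2\<close> leaves the
  claim.\<close>

lemma gap_quadratic:
  assumes m: "0 < m" and res: "\<And>s. 0 < s \<Longrightarrow> s < 2 * m \<Longrightarrow> \<exists>G. resolvent_at D A s G"
    and x: "x \<in> D"
  shows "2 * m * inner (A x) x \<le> (norm (A x))\<^sup>2"
proof -
  obtain H where H: "resolvent_at D A m H"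
    using res[of m] m by auto
  have "norm x = norm (H (A x - m *\<^sub>R x))"
    using H x by (simp add: resolvent_at_def)
  also have "\<dots> \<le> onorm H * norm (A x - m *\<^sub>R x)"
    using H by (intro onorm) (simp add: resolvent_at_def)
  also have "\<dots> \<le> 1 / m * norm (A x - m *\<^sub>R x)"
    by (intro mult_right_mono onorm_resolvent_le[OF m res H]) auto
  finally have "m * norm x \<le> norm (A x - m *\<^sub>R x)"
    using m by (simp add: field_simps)
  then have "(m * norm x)\<^sup>2 \<le> (norm (A x - m *\<^sub>R x))\<^sup>2"
    using m by (intro power_mono) auto
  also have "\<dots> = (norm (A x))\<^sup>2 - 2 * m * inner (A x) x + (m * norm x)\<^sup>2"
    using dot_norm_neg[of "A x" "m *\<^sub>R x"] m by (simp add: field_simps)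
  finally show ?thesis
    by simp
qed

text \<open>Applying \<open>A\<close> removes the kernel component. Cauchy-Schwarz for the pair
  \<open>x\<close>, \<open>A x\<close> bounds the fourth power of \<open>norm (A x)\<close>;
  combined with \<open>quad\<close>, one factor \<open>(norm (A x))\<^sup>2\<close> cancels.\<close>

lemma gap_on_range:
  assumes quad: "\<And>x. x \<in> D \<Longrightarrow> \<delta> * inner (A x) x \<le> (norm (A x))\<^sup>2" and \<delta>: "0 < \<delta>"
    and x: "x \<in> D" "A x \<in> D"
  shows "\<delta> * (norm (A x))\<^sup>2 \<le> inner (A (A x)) (A x)"
proof (cases "A x = 0")
  case True
  with nonneg[OF x(2)] show ?thesis by simp
next
  case False
  have "((norm (A x))\<^sup>2)\<^sup>2 = (inner (A x) (A x))\<^sup>2"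
    by (simp add: power2_norm_eq_inner)
  also have "\<dots> \<le> inner (A x) x * inner (A (A x)) (A x)"
    by (rule Cauchy_Schwarz[OF x])
  finally have "\<delta> * ((norm (A x))\<^sup>2)\<^sup>2 \<le> \<delta> * inner (A x) x * inner (A (A x)) (A x)"
    using \<delta> by (simp add: mult.assoc)
  also have "\<dots> \<le> (norm (A x))\<^sup>2 * inner (A (A x)) (A x)"
    using quad[OF x(1)] nonneg[OF x(2)] by (intro mult_right_mono) auto
  finally have "(norm (A x))\<^sup>2 * (\<delta> * (norm (A x))\<^sup>2) \<le> (norm (A x))\<^sup>2 * inner (A (A x)) (A x)"
    by (simp add: power2_eq_square algebra_simps)
  then show ?thesis
    by (rule mult_left_le_imp_le) (use False in simp)
qed

end

text \<open>
  As \<open>\<lambda>\<close> tends to zero, \<open>A (A + \<lambda>)\<^sup>-\<^sup>1 x\<close> converges to the component of \<open>x\<close> orthogonal to the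
  kernel, and these approximations lie in the part of the range where \<open>gap_on_range\<close> applies.
\<close>
lemma (in nonneg_symmetric) gap_modulo_kernel:
  assumes complete: "complete (UNIV :: 'a set)"
    and quad: "\<And>x. x \<in> D \<Longrightarrow> \<delta> * inner (A x) x \<le> (norm (A x))\<^sup>2" and \<delta>: "0 < \<delta>"
    and res: "\<And>s. - \<epsilon> < s \<Longrightarrow> s < 0 \<Longrightarrow> \<exists>G. resolvent_at D A s G" and \<epsilon>: "0 < \<epsilon>"
    and closed: "\<And>X x y. (\<And>n. X n \<in> D) \<Longrightarrow> X \<longlonglongrightarrow> x \<Longrightarrow> (\<lambda>n. A (X n)) \<longlonglongrightarrow> y \<Longrightarrow> x \<in> D \<and> A x = y"
    and x: "x \<in> D"
  obtains y where "y \<in> D" "A y = A x" "\<delta> * (norm y)\<^sup>2 \<le> inner (A x) x"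
proof -
  \<comment> \<open>The summand 2 makes \<open>l 0 = \<epsilon> / 2\<close>, so that every
    \<open>- l n\<close> lies strictly between \<open>- \<epsilon>\<close> and 0.\<close>
  define l where "l n = \<epsilon> / (real n + 2)" for n
  have l: "0 < l n" "l n < \<epsilon>" for n
    using \<epsilon> by (auto simp: l_def field_simps intro: add_strict_increasing)
  have l0: "l \<longlonglongrightarrow> 0"
    using LIMSEQ_ignore_initial_segment[OF lim_const_over_n[of \<epsilon>], of 2]
    by (simp add: l_def[abs_def] add.commute)
  have "\<exists>K. \<forall>n. resolvent_at D A (- l n) (K n)"
    using res l by (intro choice) auto
  then obtain K where K: "\<And>n. resolvent_at D A (- l n) (K n)"
    by blast
  have KD: "K n z \<in> D" "A (K n z) = z - l n *\<^sub>R K n z" for n z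
    using K[of n] by (auto simp: resolvent_at_def eq_diff_eq)
  define Y where "Y n = A (K n x)" for n
  have YD: "Y n \<in> D" for n
    unfolding Y_def KD(2) using x KD(1) subspace_dom by (intro subspace_diff subspace_scale)
  have AY: "A (Y n) = A x - l n *\<^sub>R Y n" for n
  proof -
    have "A (Y n) = A x - A (l n *\<^sub>R K n x)"
      using x KD(1) subspace_dom by (subst Y_def, subst KD(2)) (intro diff subspace_scale)
    then show ?thesis
      by (simp add: scaleR KD(1) Y_def)
  qed
  \<comment> \<open>Nonnegativity of \<open>A\<close> makes A (A + \<lambda>)^-1 a contraction for
    every positive \<lambda>.\<close>
  have Y_le: "norm (Y n) \<le> norm x" for n
  proof -
    have xeq: "x = Y n + l n *\<^sub>R K n x"
      using KD(2)[of n x] by (simp add: Y_def)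
    have "0 \<le> inner (Y n) (K n x)"
      using nonneg[OF KD(1)] by (simp add: Y_def)
    then have "(norm (Y n))\<^sup>2 \<le> inner (Y n) (Y n + l n *\<^sub>R K n x)"
      using l(1)[of n] by (simp add: power2_norm_eq_inner inner_simps)
    also have "\<dots> = inner (Y n) x"
      using xeq by simp
    also have "\<dots> \<le> norm (Y n) * norm x"
      by (rule norm_cauchy_schwarz)
    finally show ?thesis
      by (metis mult_le_cancel_left_pos norm_ge_zero order_le_less power2_eq_square)
  qed
  have lY: "(\<lambda>n. l n *\<^sub>R Y n) \<longlonglongrightarrow> 0"
  proof (rule Lim_null_comparison)
    show "\<forall>\<^sub>F n in sequentially. norm (l n *\<^sub>R Y n) \<le> l n * norm x"
      using l Y_le by (auto intro!: always_eventually mult_left_mono simp: less_imp_le abs_of_pos)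
    show "(\<lambda>n. l n * norm x) \<longlonglongrightarrow> 0"
      using tendsto_mult_left_zero[OF l0] by simp
  qed
  \<comment> \<open>The difference lies in the range of \<open>A\<close>, where the gap holds. Its
    image under \<open>A\<close> loses the common term \<open>A x\<close>, so only terms that tend
    to zero remain; this makes \<open>Y\<close> a Cauchy sequence.\<close>
  have bound: "\<delta> * norm (Y i - Y j) \<le> norm (l i *\<^sub>R Y i - l j *\<^sub>R Y j)" for i j
  proof -
    let ?z = "K i x - K j x"
    have z: "?z \<in> D" "A ?z = Y i - Y j"
      using KD(1) subspace_dom by (auto intro: subspace_diff simp: diff Y_def)
    have D: "A ?z \<in> D"
      unfolding z using YD subspace_dom by (auto intro: subspace_diff)
    have "\<delta> * (norm (Y i - Y j))\<^sup>2 \<le> inner (A (Y i - Y j)) (Y i - Y j)"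
      using gap_on_range[OF quad \<delta> z(1) D] by (simp add: z(2))
    also have "\<dots> \<le> norm (A (Y i - Y j)) * norm (Y i - Y j)"
      by (rule norm_cauchy_schwarz)
    also have "A (Y i - Y j) = l j *\<^sub>R Y j - l i *\<^sub>R Y i"
      by (simp add: diff YD AY)
    finally have "\<delta> * (norm (Y i - Y j))\<^sup>2 \<le> norm (l j *\<^sub>R Y j - l i *\<^sub>R Y i) * norm (Y i - Y j)" .
    then have "norm (Y i - Y j) * (\<delta> * norm (Y i - Y j))
        \<le> norm (Y i - Y j) * norm (l i *\<^sub>R Y i - l j *\<^sub>R Y j)"
      by (simp add: power2_eq_square algebra_simps norm_minus_commute)
    then show ?thesis
      by (cases "Y i = Y j") (auto simp: mult_le_cancel_left)
  qed
  have "Cauchy Y"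
  proof (rule CauchyI)
    fix e :: real assume "0 < e"
    then have "0 < \<delta> * e" using \<delta> by simp
    then obtain M where M: "\<And>i j. i \<ge> M \<Longrightarrow> j \<ge> M \<Longrightarrow> norm (l i *\<^sub>R Y i - l j *\<^sub>R Y j) < \<delta> * e"
      using CauchyD[OF convergent_Cauchy[OF convergentI[OF lY]]] by blast
    have "norm (Y i - Y j) < e" if "i \<ge> M" "j \<ge> M" for i j
      using le_less_trans[OF bound[of i j] M[OF that]] \<delta> by simp
    then show "\<exists>M. \<forall>m\<ge>M. \<forall>n\<ge>M. norm (Y m - Y n) < e" by blast
  qed
  then obtain y where y: "Y \<longlonglongrightarrow> y"
    using complete by (auto simp: complete_def)
  have AYlim: "(\<lambda>n. A (Y n)) \<longlonglongrightarrow> A x"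
    using tendsto_diff[OF tendsto_const lY, of "A x"] by (simp add: AY)
  have yD: "y \<in> D \<and> A y = A x"
    by (rule closed[OF YD y AYlim])
  have lim1: "(\<lambda>n. \<delta> * (norm (Y n))\<^sup>2) \<longlonglongrightarrow> \<delta> * (norm y)\<^sup>2"
    by (intro tendsto_intros y)
  have lim2: "(\<lambda>n. inner (A (Y n)) (Y n)) \<longlonglongrightarrow> inner (A x) y"
    by (intro tendsto_intros y AYlim)
  have le: "\<delta> * (norm (Y n))\<^sup>2 \<le> inner (A (Y n)) (Y n)" for n
    using gap_on_range[OF quad \<delta> KD(1)] YD by (simp add: Y_def)
  have "\<delta> * (norm y)\<^sup>2 \<le> inner (A x) y"
    by (rule LIMSEQ_le[OF lim1 lim2]) (use le in auto)
  \<comment> \<open>Symmetry moves \<open>A\<close> onto \<open>y\<close>, and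
    \<open>A y = A x\<close>.\<close>
  also have "inner (A x) y = inner (A x) x"
    using sym[OF x, of y] sym[OF x x] yD by (simp add: inner_commute)
  finally show thesis
    using that yD by blast
qed

section \<open>Spectral gap of a self-adjoint operator\<close>

text \<open>Since Re (- i z) = Im z, the imaginary part is again a real scalar product; continuity
  of \<open>cinner\<close> thus reduces to that of \<open>inner\<close>.\<close>

lemma cinner_eq_Complex: "cinner x y = Complex (inner x y) (inner ((- \<i>) *\<^sub>C x) y)"
  by (simp add: complex_eq_iff inner_eq_Re_cinner cinner_scaleC_left)

lemma tendsto_cinner_right:
  assumes "(f \<longlongrightarrow> y) F"
  shows "((\<lambda>t. cinner x (f t)) \<longlongrightarrow> cinner x y) F"
  unfolding cinner_eq_Complex by (intro tendsto_intros assms)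

lemma densely_defined_inner_eqD:
  assumes "densely_defined A" and eq: "\<And>x. x \<in> dom A \<Longrightarrow> inner x y = inner x z"
  shows "y = z"
proof -
  have "closed {x. inner x (y - z) = 0}"
    by (intro closed_Collect_eq continuous_intros)
  moreover have "dom A \<subseteq> {x. inner x (y - z) = 0}"
    using eq by (auto simp: inner_diff_right)
  ultimately have "closure (dom A) \<subseteq> {x. inner x (y - z) = 0}"
    by (rule closure_minimal[rotated])
  then have "y - z \<in> {x. inner x (y - z) = 0}"
    using assms(1) unfolding densely_defined_def by blast
  then show ?thesis
    by simp
qed

text \<open>Density makes the vector under \<open>THE\<close> unique, so the graph of the adjoint is
  described by its defining identity in both directions.\<close>

lemma op_adjoint_eq_Some_iff:
  assumes "densely_defined A"
  shows "op_adjoint A y = Some z \<longleftrightarrow> (\<forall>x\<in>dom A. cinner (the (A x)) y = cinner x z)"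
proof -
  let ?P = "\<lambda>w. \<forall>x\<in>dom A. cinner (the (A x)) y = cinner x w"
  have uniq: "v = w" if "?P v" "?P w" for v w
    using that by (intro densely_defined_inner_eqD[OF assms]) (simp add: inner_eq_Re_cinner)
  then have the_eq: "(THE w. ?P w) = w" if "?P w" for w
    using that by (intro the_equality) blast+
  show ?thesis
  proof (cases "\<exists>w. ?P w")
    case True
    then obtain w where w: "?P w" ..
    have "op_adjoint A y = Some w"
      unfolding op_adjoint_def if_P[OF True] by (rule arg_cong[OF the_eq[OF w]])
    moreover have "?P z \<longleftrightarrow> w = z"
    proof
      show "?P z \<Longrightarrow> w = z"
        by (rule uniq[OF w])
      show "?P z" if "w = z"
        using w unfolding that .
    qed
    ultimately show ?thesis
      by (simp only: option.inject)
  next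
    case False
    then have "op_adjoint A y = None"
      unfolding op_adjoint_def by (rule if_not_P)
    with False show ?thesis
      by simp
  qed
qed

lemma linear_operatorD:
  assumes "linear_operator A"
  shows "0 \<in> dom A" "the (A 0) = 0"
    and "x \<in> dom A \<Longrightarrow> y \<in> dom A \<Longrightarrow> x + y \<in> dom A \<and> the (A (x + y)) = the (A x) + the (A y)"
    and "x \<in> dom A \<Longrightarrow> r *\<^sub>R x \<in> dom A \<and> the (A (r *\<^sub>R x)) = r *\<^sub>R the (A x)"
  using assms by (fastforce simp: linear_operator_def scaleR_eq_scaleC dom_def)+

lemma self_adjoint_nonneg_symmetric:
  assumes "self_adjoint A" "positive_semidefinite A"
  shows "nonneg_symmetric (dom A) (\<lambda>x. the (A x))"
proof
  have lin: "linear_operator A" and dense: "densely_defined A" and adj: "op_adjoint A = A"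
    using assms(1) by (auto simp: self_adjoint_def)
  show "subspace (dom A)"
    unfolding subspace_def using linear_operatorD[OF lin] by blast
  fix x y :: 'a and c :: real
  show "x \<in> dom A \<Longrightarrow> y \<in> dom A \<Longrightarrow> the (A (x + y)) = the (A x) + the (A y)"
    and "x \<in> dom A \<Longrightarrow> the (A (c *\<^sub>R x)) = c *\<^sub>R the (A x)"
    using linear_operatorD[OF lin] by blast+
  show "inner (the (A x)) y = inner x (the (A y))" if "x \<in> dom A" "y \<in> dom A"
  proof -
    have "op_adjoint A y = Some (the (A y))"
      using that by (auto simp: adj)
    then show ?thesis
      using op_adjoint_eq_Some_iff[OF dense] that by (metis inner_eq_Re_cinner)
  qed
  show "x \<in> dom A \<Longrightarrow> 0 \<le> inner (the (A x)) x"
    using assms(2) by (simp add: positive_semidefinite_def inner_eq_Re_cinner)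
qed

text \<open>Graphs of adjoints are closed: the defining identity, tested against a fixed vector of
  the domain, passes to the limit.\<close>

lemma self_adjoint_closed:
  assumes "self_adjoint A" "\<And>n. X n \<in> dom A" "X \<longlonglongrightarrow> x" "(\<lambda>n. the (A (X n))) \<longlonglongrightarrow> y"
  shows "x \<in> dom A \<and> the (A x) = y"
proof -
  have dense: "densely_defined A" and adj: "op_adjoint A = A"
    using assms(1) by (auto simp: self_adjoint_def)
  have "cinner (the (A z)) x = cinner z y" if z: "z \<in> dom A" for z
  proof -
    have "cinner (the (A z)) (X n) = cinner z (the (A (X n)))" for n
      using op_adjoint_eq_Some_iff[OF dense, of "X n" "the (A (X n))"] assms(2)[of n] z
      by (auto simp: adj)
    then have "(\<lambda>n. cinner z (the (A (X n)))) \<longlonglongrightarrow> cinner (the (A z)) x"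
      using tendsto_cinner_right[OF assms(3), of "the (A z)"] by simp
    then show ?thesis
      using tendsto_cinner_right[OF assms(4)] LIMSEQ_unique by blast
  qed
  then have "A x = Some y"
    using op_adjoint_eq_Some_iff[OF dense, of x y] by (simp add: adj)
  then show ?thesis
    by auto
qed

text \<open>This is why \<open>J\<close> drops out of the energy balance: the real part of its
  quadratic form equals its own negative.\<close>

lemma skew_adjoint_inner_eq_0:
  assumes "skew_adjoint A" "x \<in> dom A"
  shows "inner (the (A x)) x = 0"
proof -
  have "op_adjoint A x = Some (- the (A x))"
    using assms by (auto simp: skew_adjoint_def op_uminus_def)
  then have "inner (the (A x)) x = inner x (- the (A x))"
    using assms op_adjoint_eq_Some_iff[of A x]
    by (simp add: skew_adjoint_def inner_eq_Re_cinner)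
  then show ?thesis
    by (simp add: inner_commute)
qed

lemma resolvent_set_resolvent_at:
  assumes "complex_of_real s \<in> resolvent_set A"
  shows "\<exists>G. resolvent_at (dom A) (\<lambda>x. the (A x)) s G"
  using assms unfolding resolvent_set_def resolvent_at_def bounded_clinear_def scaleR_eq_scaleC
  by blast

text \<open>The vector \<open>x - y\<close> belongs to the kernel and has distance
  \<open>norm y\<close> from \<open>x\<close>. Hence any preimage of the same value bounds the
  distance, without an orthogonal projection.\<close>

lemma infdist_kernel_le:
  assumes "x \<in> dom A" "y \<in> dom A" "the (A y) = the (A x)" "linear_operator A"
  shows "infdist x (op_kernel A) \<le> norm y"
proof -
  have "A (x - y) = Some 0"
  proof -
    have "- 1 *\<^sub>R y \<in> dom A" "the (A (- 1 *\<^sub>R y)) = - the (A y)"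
      using linear_operatorD(4)[OF assms(4,2), of "-1"] by auto
    then have "x - y \<in> dom A" "the (A (x - y)) = 0"
      using linear_operatorD(3)[OF assms(4,1), of "- 1 *\<^sub>R y"] assms(3) by auto
    then show ?thesis
      by auto
  qed
  then have "infdist x (op_kernel A) \<le> dist x (x - y)"
    by (intro infdist_le) (simp add: op_kernel_def)
  then show ?thesis
    by (simp add: dist_norm)
qed

theorem spectral_gap:
  fixes A :: "'a::chilbert_space \<rightharpoonup> 'a"
  assumes sa: "self_adjoint A" and psd: "positive_semidefinite A"
    and spec: "0 \<in> discrete_spectrum A \<union> resolvent_set A"
  shows "\<exists>\<delta>>0. \<forall>x\<in>dom A. \<delta> * (infdist x (op_kernel A))\<^sup>2 \<le> inner (the (A x)) x"
proof -
  interpret nonneg_symmetric "dom A" "\<lambda>x. the (A x)"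
    by (rule self_adjoint_nonneg_symmetric[OF sa psd])
  have lin: "linear_operator A"
    using sa by (simp add: self_adjoint_def)
  have "\<exists>\<delta>>0. \<forall>x\<in>dom A. \<exists>y\<in>dom A. the (A y) = the (A x) \<and> \<delta> * (norm y)\<^sup>2 \<le> inner (the (A x)) x"
  proof (cases "0 \<in> resolvent_set A")
    case True
    then obtain G where G: "resolvent_at (dom A) (\<lambda>x. the (A x)) 0 G"
      using resolvent_set_resolvent_at[of 0 A] by auto
    then have bG: "bounded_linear G" and GD: "\<And>y. G y \<in> dom A" "\<And>y. the (A (G y)) = y"
      "\<And>x. x \<in> dom A \<Longrightarrow> G (the (A x)) = x"
      by (auto simp: resolvent_at_def)
    \<comment> \<open>Adding 1 keeps the denominator positive even when \<open>onorm G\<close> is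
      0.\<close>
    define \<delta> where "\<delta> = 1 / (onorm G + 1)"
    have g: "0 \<le> onorm G"
      by (rule onorm_pos_le[OF bG])
    then have \<delta>: "0 < \<delta>" "\<delta> * onorm G \<le> 1"
      by (auto simp: \<delta>_def)
    have quad: "\<delta> * inner (the (A x)) x \<le> (norm (the (A x)))\<^sup>2" if x: "x \<in> dom A" for x
    proof -
      have "inner (the (A x)) x \<le> norm (the (A x)) * norm x"
        by (rule norm_cauchy_schwarz)
      also have "norm x \<le> onorm G * norm (the (A x))"
        using onorm[OF bG, of "the (A x)"] GD(3)[OF x] by simp
      finally have "\<delta> * inner (the (A x)) x \<le> \<delta> * (norm (the (A x)) * (onorm G * norm (the (A x))))"
        using \<delta> by (simp add: mult_left_mono)
      also have "\<dots> = \<delta> * onorm G * (norm (the (A x)))\<^sup>2"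
        by (simp add: power2_eq_square)
      also have "\<dots> \<le> (norm (the (A x)))\<^sup>2"
        using mult_right_mono[OF \<delta>(2), of "(norm (the (A x)))\<^sup>2"] by simp
      finally show ?thesis .
    qed
    \<comment> \<open>Every \<open>x\<close> in the domain is the image of \<open>G x\<close>, so
      the estimate on the range covers the whole domain and \<open>x\<close> itself serves as
      \<open>y\<close>.\<close>
    have "\<delta> * (norm x)\<^sup>2 \<le> inner (the (A x)) x" if "x \<in> dom A" for x
      using gap_on_range[of \<delta> "G x", OF quad \<delta>(1) GD(1)] that by (simp add: GD)
    then show ?thesis
      using \<delta>(1) by blast
  next
    case False
    then obtain e where e: "0 < e" "\<And>s. s \<in> op_spectrum A \<Longrightarrow> dist 0 s < e \<Longrightarrow> s = 0"
      using spec by (auto simp: discrete_spectrum_def elim!: isolated_inE_dist)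
    have res: "\<exists>G. resolvent_at (dom A) (\<lambda>x. the (A x)) s G" if "s \<noteq> 0" "\<bar>s\<bar> < e" for s
      using e(2)[of "complex_of_real s"] that
      by (intro resolvent_set_resolvent_at) (auto simp: op_spectrum_def)
    \<comment> \<open>With \<open>m = e / 2\<close> the interval from 0 to \<open>2 * m\<close> is
      exactly the positive half of the punctured neighbourhood free of spectrum.\<close>
    have quad: "e * inner (the (A x)) x \<le> (norm (the (A x)))\<^sup>2" if "x \<in> dom A" for x
      using gap_quadratic[of "e / 2" x] res that e(1) by simp
    have "\<exists>y\<in>dom A. the (A y) = the (A x) \<and> e * (norm y)\<^sup>2 \<le> inner (the (A x)) x"
      if x: "x \<in> dom A" for x
    proof (rule gap_modulo_kernel[OF complete_UNIV quad e(1) _ e(1) _ x])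
      show "\<exists>G. resolvent_at (dom A) (\<lambda>x. the (A x)) s G" if "- e < s" "s < 0" for s
        using that by (intro res) auto
    qed (use self_adjoint_closed[OF sa] in blast)+
    then show ?thesis
      using e(1) by blast
  qed
  then obtain \<delta> where \<delta>: "0 < \<delta>" and y: "\<And>x. x \<in> dom A \<Longrightarrow>
      \<exists>y\<in>dom A. the (A y) = the (A x) \<and> \<delta> * (norm y)\<^sup>2 \<le> inner (the (A x)) x"
    by blast
  have "\<delta> * (infdist x (op_kernel A))\<^sup>2 \<le> inner (the (A x)) x" if x: "x \<in> dom A" for x
  proof -
    from x obtain y where y: "y \<in> dom A" "the (A y) = the (A x)"
      "\<delta> * (norm y)\<^sup>2 \<le> inner (the (A x)) x"
      using y by blast
    have "\<delta> * (infdist x (op_kernel A))\<^sup>2 \<le> \<delta> * (norm y)\<^sup>2"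
      using infdist_kernel_le[OF x y(1,2) lin] \<delta>
      by (intro mult_left_mono power_mono) (auto simp: infdist_nonneg)
    with y(3) show ?thesis
      by linarith
  qed
  with \<delta> show ?thesis
    by blast
qed

section \<open>Energy decay of dissipative semigroups\<close>

text \<open>A slope \<open>e\<close> is conceded. The bound
  \<open>f t \<le> f a + e * (t - a)\<close> extends to the supremum of its initial intervals by
  continuity, and the right Dini estimate pushes it beyond any such supremum less than
  \<open>b\<close>.\<close>

lemma nonincreasing_if_right_Dini_nonpos:
  fixes f :: "real \<Rightarrow> real"
  assumes ab: "a \<le> b" and cont: "continuous_on {a..b} f"
    and Dini: "\<And>t e. a \<le> t \<Longrightarrow> t < b \<Longrightarrow> 0 < e \<Longrightarrow>
      \<exists>d>0. \<forall>h. 0 < h \<and> h < d \<longrightarrow> f (t + h) - f t \<le> e * h"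
  shows "f b \<le> f a"
proof (rule field_le_epsilon)
  fix e0 :: real assume e0: "0 < e0"
  \<comment> \<open>The total slack over the interval stays below \<open>e0\<close>; the summand 1
    covers \<open>a = b\<close>.\<close>
  define e where "e = e0 / (b - a + 1)"
  have e: "0 < e" "e * (b - a) \<le> e0"
    using e0 ab by (auto simp: e_def field_simps)
  define T where "T = {t \<in> {a..b}. f t \<le> f a + e * (t - a)}"
  define S where "S = {t \<in> {a..b}. {a..t} \<subseteq> T}"
  have T: "closed T"
    unfolding T_def by (intro continuous_on_closed_Collect_le continuous_intros cont closed_atLeastAtMost)
  have aS: "a \<in> S"
    using ab by (auto simp: S_def T_def)
  have bdd: "bdd_above S"
    by (rule bdd_aboveI[of _ b]) (simp add: S_def)
  define c where "c = Sup S"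
  have c: "a \<le> c" "c \<le> b"
    using cSup_upper[OF aS bdd] aS by (auto simp: c_def S_def intro!: cSup_least)
  have lt: "s \<in> T" if "a \<le> s" "s < c" for s
  proof -
    obtain t where "t \<in> S" "s < t"
      using \<open>s < c\<close> less_cSup_iff[OF _ bdd] aS by (auto simp: c_def)
    then show ?thesis
      using that by (auto simp: S_def)
  qed
  have "S \<subseteq> T"
    by (auto simp: S_def)
  then have "c \<in> T"
    using closure_contains_Sup[of S] aS bdd T closure_minimal[of S T] by (auto simp: c_def)
  have "c = b"
  proof (rule ccontr)
    assume "c \<noteq> b"
    then obtain d where d: "0 < d" "\<And>h. 0 < h \<Longrightarrow> h < d \<Longrightarrow> f (c + h) - f c \<le> e * h"
      using Dini[of c e] c e by auto
    define k where "k = min (d / 2) (b - c)"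
    have k: "0 < k" "k < d" "c + k \<le> b"
      using d(1) c \<open>c \<noteq> b\<close> by (auto simp: k_def)
    have "s \<in> T" if "a \<le> s" "s \<le> c + k" for s
    proof (cases "s \<le> c")
      case True
      then show ?thesis
        using lt[OF that(1)] \<open>c \<in> T\<close> by (cases "s = c") auto
    next
      case False
      have "f s - f c \<le> e * (s - c)"
        using d(2)[of "s - c"] False that k by auto
      then show ?thesis
        using \<open>c \<in> T\<close> that k by (auto simp: T_def algebra_simps)
    qed
    then have "c + k \<in> S"
      using c k by (auto simp: S_def)
    then show False
      using cSup_upper[OF _ bdd, of "c + k"] k by (simp add: c_def)
  qed
  then show "f b \<le> f a + e0"
    using \<open>c \<in> T\<close> e by (auto simp: T_def)
qed

section \<open>Local boundedness and strong continuity of semigroups\<close>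

lemma C0_semigroupD:
  assumes "C0_semigroup S"
  shows "0 \<le> t \<Longrightarrow> bounded_linear (S t)" "S 0 = id"
    and "0 \<le> s \<Longrightarrow> 0 \<le> t \<Longrightarrow> S (s + t) x = S s (S t x)"
    and "((\<lambda>t. S t x) \<longlongrightarrow> x) (at_right 0)"
  using assms by (auto simp: C0_semigroup_def bounded_clinear_def)

text \<open>A Baire category argument: strong continuity controls each orbit only up to a time
  depending on \<open>x\<close>, so both the bound and the time window in \<open>F n\<close> vary
  with \<open>n\<close>. One of these closed sets has interior.\<close>

lemma C0_semigroup_bounded_near_0:
  fixes S :: "real \<Rightarrow> 'a::chilbert_space \<Rightarrow> 'a"
  assumes S: "C0_semigroup S"
  shows "\<exists>h>0. \<exists>C\<ge>0. \<forall>t\<in>{0..h}. \<forall>x. norm (S t x) \<le> C * norm x"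
proof -
  define F where "F n = {x. \<forall>t\<in>{0..1 / Suc n}. norm (S t x) \<le> real n}" for n
  have "closed (F n)" for n
  proof -
    have "closed {x. norm (S t x) \<le> real n}" if "t \<in> {0..1 / Suc n}" for t
      using C0_semigroupD(1)[OF S, of t] that
      by (intro closed_Collect_le continuous_intros linear_continuous_on) auto
    moreover have "F n = (\<Inter>t\<in>{0..1 / Suc n}. {x. norm (S t x) \<le> real n})"
      by (auto simp: F_def)
    ultimately show ?thesis
      by (metis (mono_tags, lifting) closed_INT)
  qed
  have "x \<in> (\<Union>n. F n)" for x
  proof -
    have "\<forall>\<^sub>F t in at_right 0. dist (S t x) x < 1"
      by (rule tendstoD[OF C0_semigroupD(4)[OF S]]) simp
    then obtain b where b: "0 < b" "\<And>t. 0 < t \<Longrightarrow> t < b \<Longrightarrow> dist (S t x) x < 1"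
      by (auto simp: eventually_at_right_field)
    obtain n1 n2 where n: "norm x + 1 \<le> real n1" "1 / Suc n2 < b"
      using real_arch_simple[of "norm x + 1"] nat_approx_posE[OF b(1)] by metis
    define n where "n = max n1 n2"
    have "1 / Suc n \<le> 1 / Suc n2"
      by (simp add: n_def field_simps)
    with n have n': "norm x + 1 \<le> real n" "1 / Suc n < b"
      by (auto simp: n_def)
    have "norm (S t x) \<le> real n" if "0 \<le> t" "t \<le> 1 / Suc n" for t
    proof (cases "t = 0")
      case True
      then show ?thesis
        using n'(1) C0_semigroupD(2)[OF S] by simp
    next
      case False
      then have "norm (S t x - x) < 1"
        using b(2)[of t] that n'(2) by (simp add: dist_norm)
      then show ?thesis
        using n'(1) norm_triangle_ineq2[of "S t x" x] by linarith
    qed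
    then have "x \<in> F n"
      unfolding F_def by auto
    then show ?thesis
      by blast
  qed
  then have U: "(\<Union>n. F n) = UNIV"
    by blast
  have "\<exists>n. interior (F n) \<noteq> {}"
  proof (rule ccontr)
    assume "\<nexists>n. interior (F n) \<noteq> {}"
    then have "euclidean interior_of \<Union>(range F) = {}"
      using \<open>\<And>n. closed (F n)\<close>
      by (intro Baire_category_alt disjI1 completely_metrizable_space_euclidean) auto
    then show False
      using U by simp
  qed
  then obtain n x0 r where r: "0 < r" "ball x0 r \<subseteq> F n"
    by (metis ex_in_conv mem_interior)
  \<comment> \<open>Both \<open>x0\<close> and \<open>x0 + a *\<^sub>R x\<close> lie in the ball for
    \<open>a = r / (2 * norm x)\<close>. Subtracting their images bounds
    \<open>a * norm (S t x)\<close> by \<open>2 * n\<close>, whence the factor 4.\<close>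
  have "norm (S t x) \<le> 4 * real n / r * norm x" if t: "0 \<le> t" "t \<le> 1 / real (Suc n)" for t x
  proof -
    have lin: "bounded_linear (S t)"
      by (rule C0_semigroupD(1)[OF S t(1)])
    show "norm (S t x) \<le> 4 * real n / r * norm x"
    proof (cases "x = 0")
      case True
      then show ?thesis
        using linear_simps(3)[OF lin] by simp
    next
      case False
      define a where "a = r / (2 * norm x)"
      have a: "0 < a" "a * norm x < r"
        using r(1) False by (auto simp: a_def)
      have "x0 \<in> F n" "x0 + a *\<^sub>R x \<in> F n"
        using r a by (auto simp: dist_norm)
      then have "norm (S t x0) \<le> n" "norm (S t (x0 + a *\<^sub>R x)) \<le> n"
        using t by (auto simp: F_def)
      moreover have "a *\<^sub>R S t x = S t (x0 + a *\<^sub>R x) - S t x0"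
        using lin by (simp add: linear_simps)
      ultimately have "norm (a *\<^sub>R S t x) \<le> 2 * real n"
        using norm_triangle_ineq4[of "S t (x0 + a *\<^sub>R x)" "S t x0"] by simp
      then show ?thesis
        using a(1) r(1) False by (simp add: a_def field_simps)
    qed
  qed
  then have "\<forall>t\<in>{0..1 / real (Suc n)}. \<forall>x. norm (S t x) \<le> 4 * real n / r * norm x"
    by auto
  moreover have "0 < 1 / real (Suc n)" "0 \<le> 4 * real n / r"
    using r(1) by auto
  ultimately show ?thesis
    by blast
qed

text \<open>The bound on a short interval is iterated by the semigroup law. Taking
  \<open>max 1 C\<close> makes the powers dominate the bound for a single step.\<close>

lemma C0_semigroup_locally_bounded:
  fixes S :: "real \<Rightarrow> 'a::chilbert_space \<Rightarrow> 'a"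
  assumes S: "C0_semigroup S"
  shows "\<exists>C\<ge>0. \<forall>t\<in>{0..T}. \<forall>x. norm (S t x) \<le> C * norm x"
proof -
  obtain C h where h: "0 < h" "0 \<le> C" and C: "\<And>t x. 0 \<le> t \<Longrightarrow> t \<le> h \<Longrightarrow> norm (S t x) \<le> C * norm x"
    using C0_semigroup_bounded_near_0[OF S] by (metis atLeastAtMost_iff)
  have "norm (S t x) \<le> (max 1 C) ^ k * norm x" if "0 \<le> t" "t \<le> real k * h" for t x k
    using that
  proof (induction k arbitrary: t)
    case 0
    then show ?case
      using C0_semigroupD(2)[OF S] by simp
  next
    case (Suc k)
    show ?case
    proof (cases "t \<le> h")
      case True
      have "norm (S t x) \<le> C * norm x"
        by (rule C) (use Suc True in auto)
      also have "C \<le> max 1 C ^ Suc k"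
        using self_le_power[of "max 1 C" "Suc k"] by linarith
      finally show ?thesis
        by (simp add: mult_right_mono)
    next
      case False
      then have "S t x = S h (S (t - h) x)"
        using C0_semigroupD(3)[OF S, of h "t - h" x] h by simp
      then have "norm (S t x) \<le> max 1 C * norm (S (t - h) x)"
        using C[of h "S (t - h) x"] h
        by (smt (verit, best) max.cobounded2 mult_right_mono norm_ge_zero)
      also have "\<dots> \<le> max 1 C * (max 1 C ^ k * norm x)"
        using Suc False by (intro mult_left_mono Suc.IH) (auto simp: algebra_simps)
      finally show ?thesis
        by (simp add: mult.assoc)
    qed
  qed
  moreover obtain k :: nat where "T < real k * h"
    using h(1) reals_Archimedean3 by blast
  ultimately show ?thesis
    by (intro exI[of _ "max 1 C ^ k"]) auto
qed

lemma C0_semigroup_increment: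
  assumes S: "C0_semigroup S" and bound: "\<And>x. norm (S s x) \<le> C * norm x"
    and "0 \<le> s" "s \<le> t"
  shows "norm (S t x - S s x) \<le> C * norm (S (t - s) x - x)"
proof -
  have "S t x - S s x = S s (S (t - s) x - x)"
    using C0_semigroupD(3)[OF S, of s "t - s" x] C0_semigroupD(1)[OF S, of s] assms(3,4)
    by (simp add: linear_simps)
  then show ?thesis
    using bound by simp
qed

lemma C0_semigroup_near_0:
  assumes S: "C0_semigroup S" and "0 < e"
  obtains d where "0 < d" "\<And>t. 0 \<le> t \<Longrightarrow> t < d \<Longrightarrow> norm (S t x - x) < e"
proof -
  have "\<forall>\<^sub>F t in at_right 0. dist (S t x) x < e"
    by (rule tendstoD[OF C0_semigroupD(4)[OF S] assms(2)])
  then obtain d where d: "0 < d" "\<And>t. 0 < t \<Longrightarrow> t < d \<Longrightarrow> dist (S t x) x < e"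
    by (auto simp: eventually_at_right_field)
  have "norm (S t x - x) < e" if "0 \<le> t" "t < d" for t
    using d(2)[of t] that assms(2) C0_semigroupD(2)[OF S] by (cases "t = 0") (auto simp: dist_norm)
  with d(1) that show thesis
    by blast
qed

text \<open>Factoring out the semigroup at the smaller of two times reduces two-sided continuity
  anywhere to right continuity at 0.\<close>

lemma C0_semigroup_continuous:
  fixes S :: "real \<Rightarrow> 'a::chilbert_space \<Rightarrow> 'a"
  assumes S: "C0_semigroup S"
  shows "continuous_on {0..T} (\<lambda>t. S t x)"
proof -
  obtain C where C: "0 \<le> C" "\<And>t x. 0 \<le> t \<Longrightarrow> t \<le> T \<Longrightarrow> norm (S t x) \<le> C * norm x"
    using C0_semigroup_locally_bounded[OF S, of T] by (metis atLeastAtMost_iff)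
  show ?thesis
    unfolding continuous_on_iff
  proof (intro ballI allI impI)
    fix t e :: real assume t: "t \<in> {0..T}" and e: "0 < e"
    have "0 < e / (C + 1)"
      using e C(1) by simp
    then obtain d where d: "0 < d" "\<And>h. 0 \<le> h \<Longrightarrow> h < d \<Longrightarrow> norm (S h x - x) < e / (C + 1)"
      using C0_semigroup_near_0[OF S] by blast
    have "dist (S s x) (S t x) < e" if s: "s \<in> {0..T}" "dist s t < d" for s
    proof -
      have "norm (S s x - S t x) \<le> C * norm (S \<bar>s - t\<bar> x - x)"
      proof (cases "t \<le> s")
        case True
        then show ?thesis
          using C0_semigroup_increment[OF S, of t C s x] C(2) t by simp
      next
        case False
        then show ?thesis
          using C0_semigroup_increment[OF S, of s C t x] C(2) s by (simp add: norm_minus_commute)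
      qed
      also have "\<dots> \<le> C * (e / (C + 1))"
        using d(2)[of "\<bar>s - t\<bar>"] s C(1) by (intro mult_left_mono) (auto simp: dist_real_def)
      also have "\<dots> < e"
        using e C(1) by (simp add: field_simps)
      finally show ?thesis
        by (simp add: dist_norm)
    qed
    with d(1) show "\<exists>d>0. \<forall>x'\<in>{0..T}. dist x' t < d \<longrightarrow> dist (S x' x) (S t x) < e"
      by blast
  qed
qed

section \<open>Energy along orbits of the free evolution\<close>

lemma generator_eq_Some_iff:
  "generator S x = Some y \<longleftrightarrow> ((\<lambda>h. (S h x - x) /\<^sub>R h) \<longlongrightarrow> y) (at_right 0)"
  unfolding generator_def
  by (auto intro: tendsto_Lim[OF trivial_limit_at_right_real]
      simp: tendsto_Lim[OF trivial_limit_at_right_real])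

text \<open>Invariance of the domain allows the energy to be differentiated at every point of an
  orbit, not only at its start.\<close>

lemma generator_semigroup:
  assumes S: "C0_semigroup S" and x: "generator S x = Some y" and t: "0 \<le> t"
  shows "generator S (S t x) = Some (S t y)"
proof -
  have lin: "bounded_linear (S t)"
    by (rule C0_semigroupD(1)[OF S t])
  have "((\<lambda>h. S t ((S h x - x) /\<^sub>R h)) \<longlongrightarrow> S t y) (at_right 0)"
    by (rule bounded_linear.tendsto[OF lin]) (use x in \<open>simp add: generator_eq_Some_iff\<close>)
  moreover have "\<forall>\<^sub>F h in at_right 0. S t ((S h x - x) /\<^sub>R h) = (S h (S t x) - S t x) /\<^sub>R h"
    unfolding eventually_at_right_field
  proof (intro exI[of _ 1] conjI allI impI)
    fix h :: real assume "0 < h"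
    then have "S h (S t x) = S t (S h x)"
      using C0_semigroupD(3)[OF S, of h t x] C0_semigroupD(3)[OF S, of t h x] t
      by (simp add: add.commute)
    then show "S t ((S h x - x) /\<^sub>R h) = (S h (S t x) - S t x) /\<^sub>R h"
      using lin by (simp add: linear_simps)
  qed simp
  ultimately show ?thesis
    unfolding generator_eq_Some_iff by (rule Lim_transform_eventually)
qed

text \<open>A difference of squared norms is the scalar product of difference and sum, so the
  difference quotient of the energy is a product of two convergent factors.\<close>

lemma generator_norm_derivative:
  assumes S: "C0_semigroup S" and x: "generator S x = Some y"
  shows "((\<lambda>h. ((norm (S h x))\<^sup>2 / 2 - (norm x)\<^sup>2 / 2) / h) \<longlongrightarrow> inner y x) (at_right 0)"
proof -
  have "((\<lambda>h. inner ((S h x - x) /\<^sub>R h) ((S h x + x) /\<^sub>R 2)) \<longlongrightarrow> inner y ((x + x) /\<^sub>R 2)) (at_right 0)"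
    using x unfolding generator_eq_Some_iff
    by (intro tendsto_intros C0_semigroupD(4)[OF S]) auto
  moreover have "inner ((S h x - x) /\<^sub>R h) ((S h x + x) /\<^sub>R 2)
      = ((norm (S h x))\<^sup>2 / 2 - (norm x)\<^sup>2 / 2) / h" for h
  proof -
    have "inner (S h x - x) (S h x + x) = (norm (S h x))\<^sup>2 - (norm x)\<^sup>2"
      by (simp only: power2_norm_eq_inner inner_add_right inner_diff_left inner_commute[of "S h x" x])
    then have "inner ((S h x - x) /\<^sub>R h) ((S h x + x) /\<^sub>R 2)
        = inverse 2 * (inverse h * ((norm (S h x))\<^sup>2 - (norm x)\<^sup>2))"
      by (simp only: inner_scaleR_left inner_scaleR_right)
    then show ?thesis
      by (simp only: divide_inverse left_diff_distrib right_diff_distrib mult_ac)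
  qed
  moreover have "inner y ((x + x) /\<^sub>R 2) = inner y x"
    by (simp flip: scaleR_2)
  ultimately show ?thesis
    by (simp only:)
qed

text \<open>The right derivative of the energy is at most - \<delta> dist^2, hence at most -
  \<delta> r^2, along the orbit. A constant \<open>r\<close> in place of an integrated distance lets
  the estimate be perturbed easily.\<close>

lemma energy_decay_dom:
  fixes S :: "real \<Rightarrow> 'a::chilbert_space \<Rightarrow> 'a"
  assumes S: "C0_semigroup S" and \<delta>: "0 \<le> \<delta>"
    and diss: "\<And>x y. generator S x = Some y \<Longrightarrow> inner y x \<le> - \<delta> * (infdist x V)\<^sup>2"
    and x: "x \<in> dom (generator S)" and h: "0 \<le> h"
    and r: "0 \<le> r" "\<And>t. 0 \<le> t \<Longrightarrow> t \<le> h \<Longrightarrow> r \<le> infdist (S t x) V"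
  shows "(norm (S h x))\<^sup>2 / 2 + \<delta> * h * r\<^sup>2 \<le> (norm x)\<^sup>2 / 2"
proof -
  define f where "f t = (norm (S t x))\<^sup>2 / 2 + \<delta> * t * r\<^sup>2" for t
  have "f h \<le> f 0"
  proof (rule nonincreasing_if_right_Dini_nonpos[OF h])
    show "continuous_on {0..h} f"
      unfolding f_def by (intro continuous_intros C0_semigroup_continuous[OF S]) auto
    fix t e :: real assume t: "0 \<le> t" "t < h" and e: "0 < e"
    obtain y where y: "generator S (S t x) = Some y"
      using x generator_semigroup[OF S _ t(1)] by blast
    have "((\<lambda>k. ((norm (S k (S t x)))\<^sup>2 / 2 - (norm (S t x))\<^sup>2 / 2) / k + \<delta> * r\<^sup>2)
        \<longlongrightarrow> inner y (S t x) + \<delta> * r\<^sup>2) (at_right 0)"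
      by (intro tendsto_intros generator_norm_derivative[OF S y])
    moreover have "inner y (S t x) + \<delta> * r\<^sup>2 < e"
    proof -
      have "\<delta> * r\<^sup>2 \<le> \<delta> * (infdist (S t x) V)\<^sup>2"
        using r t \<delta> by (intro mult_left_mono power_mono) auto
      with diss[OF y] e show ?thesis
        by simp
    qed
    ultimately have "\<forall>\<^sub>F k in at_right 0.
        ((norm (S k (S t x)))\<^sup>2 / 2 - (norm (S t x))\<^sup>2 / 2) / k + \<delta> * r\<^sup>2 < e"
      by (rule order_tendstoD(2))
    then obtain d where d: "0 < d" "\<And>k. 0 < k \<Longrightarrow> k < d \<Longrightarrow>
        ((norm (S k (S t x)))\<^sup>2 / 2 - (norm (S t x))\<^sup>2 / 2) / k + \<delta> * r\<^sup>2 < e"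
      by (auto simp: eventually_at_right_field)
    have "f (t + k) - f t \<le> e * k" if k: "0 < k" "k < d" for k
    proof -
      have "S (t + k) x = S k (S t x)"
        using C0_semigroupD(3)[OF S, of k t x] k t by (simp add: add.commute)
      then have "f (t + k) - f t
          = (((norm (S k (S t x)))\<^sup>2 / 2 - (norm (S t x))\<^sup>2 / 2) / k + \<delta> * r\<^sup>2) * k"
        using k by (simp add: f_def field_simps)
      also have "\<dots> \<le> e * k"
        using d(2)[OF k] k by (intro mult_right_mono) auto
      finally show ?thesis .
    qed
    with d(1) show "\<exists>d>0. \<forall>k. 0 < k \<and> k < d \<longrightarrow> f (t + k) - f t \<le> e * k"
      by blast
  qed
  then show ?thesis
    using C0_semigroupD(2)[OF S] by (simp add: f_def)
qed

lemma dissipative_contraction: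
  fixes S :: "real \<Rightarrow> 'a::chilbert_space \<Rightarrow> 'a"
  assumes S: "C0_semigroup S" and dense: "densely_defined (generator S)"
    and diss: "\<And>x y. generator S x = Some y \<Longrightarrow> inner y x \<le> 0" and t: "0 \<le> t"
  shows "norm (S t x) \<le> norm x"
proof -
  \<comment> \<open>With \<delta> = 0 the distance term vanishes, so the empty set can stand for
    \<open>V\<close>.\<close>
  have "norm (S t x) \<le> norm x" if "x \<in> dom (generator S)" for x
    using energy_decay_dom[OF S order_refl, of "{}" x t 0] diss that t
    by (simp add: power2_le_iff_abs_le infdist_nonneg)
  moreover have "closed {x. norm (S t x) \<le> norm x}"
    using C0_semigroupD(1)[OF S t] by (intro closed_Collect_le continuous_intros linear_continuous_on)
  ultimately have "closure (dom (generator S)) \<subseteq> {x. norm (S t x) \<le> norm x}"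
    by (intro closure_minimal) blast+
  then show ?thesis
    using dense unfolding densely_defined_def by blast
qed

text \<open>By contractivity, replacing \<open>x\<close> by a nearby \<open>X n\<close> moves the
  whole orbit by at most \<open>dist (X n) x\<close>, so the lower bound \<open>r\<close> degrades
  by no more than that. Truncation at 0 keeps it nonnegative.\<close>

lemma energy_decay:
  fixes S :: "real \<Rightarrow> 'a::chilbert_space \<Rightarrow> 'a"
  assumes S: "C0_semigroup S" and dense: "densely_defined (generator S)" and \<delta>: "0 \<le> \<delta>"
    and diss: "\<And>x y. generator S x = Some y \<Longrightarrow> inner y x \<le> - \<delta> * (infdist x V)\<^sup>2"
    and h: "0 \<le> h"
    and r: "0 \<le> r" "\<And>t. 0 \<le> t \<Longrightarrow> t \<le> h \<Longrightarrow> r \<le> infdist (S t x) V"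
  shows "(norm (S h x))\<^sup>2 / 2 + \<delta> * h * r\<^sup>2 \<le> (norm x)\<^sup>2 / 2"
proof -
  have "inner y x \<le> 0" if "generator S x = Some y" for x y
    using diss[OF that] \<delta> by (smt (verit) mult_nonneg_nonneg mult_minus_left zero_le_power2)
  then have contr: "norm (S t z) \<le> norm z" if "0 \<le> t" for t z
    using dissipative_contraction[OF S dense] that by blast
  obtain X where X: "\<And>n. X n \<in> dom (generator S)" "X \<longlonglongrightarrow> x"
    using dense unfolding densely_defined_def by (metis UNIV_I closure_sequential)
  define rn where "rn n = max 0 (r - dist (X n) x)" for n
  have le: "(norm (S h (X n)))\<^sup>2 / 2 + \<delta> * h * (rn n)\<^sup>2 \<le> (norm (X n))\<^sup>2 / 2" for n
  proof (rule energy_decay_dom[OF S \<delta> diss X(1) h])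
    fix t assume t: "0 \<le> t" "t \<le> h"
    have "dist (S t x) (S t (X n)) \<le> dist (X n) x"
      using contr[OF t(1), of "x - X n"] C0_semigroupD(1)[OF S t(1)]
      by (simp add: dist_norm linear_simps norm_minus_commute)
    then show "rn n \<le> infdist (S t (X n)) V"
      using r(2)[OF t] infdist_triangle[of "S t x" V "S t (X n)"] infdist_nonneg[of "S t (X n)" V]
      by (simp add: rn_def)
  qed (auto simp: rn_def)
  have "rn \<longlonglongrightarrow> max 0 (r - dist x x)"
    unfolding rn_def by (intro tendsto_intros X)
  then have rn: "rn \<longlonglongrightarrow> r"
    using r(1) by simp
  have SX: "(\<lambda>n. S h (X n)) \<longlonglongrightarrow> S h x"
    by (rule bounded_linear.tendsto[OF C0_semigroupD(1)[OF S h] X(2)])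
  show ?thesis
    by (rule LIMSEQ_le[of "\<lambda>n. (norm (S h (X n)))\<^sup>2 / 2 + \<delta> * h * (rn n)\<^sup>2" _ "\<lambda>n. (norm (X n))\<^sup>2 / 2"])
      (use le in \<open>auto intro!: tendsto_intros SX rn X(2)\<close>)
qed

section \<open>Mild solutions\<close>

lemma set_integrable_bounded:
  fixes g :: "real \<Rightarrow> 'a::{banach, second_countable_topology}"
  assumes "g \<in> borel_measurable lebesgue" "\<And>s. s \<in> {a..b} \<Longrightarrow> norm (g s) \<le> C"
  shows "set_integrable lebesgue {a..b} g"
proof (rule set_integrable_bound)
  show "set_integrable lebesgue {a..b} (\<lambda>_. C)"
    unfolding set_integrable_def
    by (intro integrable_scaleR_left integrable_real_indicator) (auto simp: emeasure_lborel_Icc_eq)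
  show "set_borel_measurable lebesgue {a..b} g"
    unfolding set_borel_measurable_def
    by (intro borel_measurable_scaleR borel_measurable_indicator assms(1)) auto
  show "AE s in lebesgue. s \<in> {a..b} \<longrightarrow> norm (g s) \<le> norm C"
  proof (intro AE_I2 impI)
    fix s assume "s \<in> {a..b}"
    from assms(2)[OF this] show "norm (g s) \<le> norm C"
      by simp
  qed
qed

lemma set_integral_Icc_combine:
  fixes g :: "real \<Rightarrow> 'a::{banach, second_countable_topology}"
  assumes "set_integrable lebesgue {a..b} g" "a \<le> c" "c \<le> b"
  shows "(LINT s:{a..b}|lebesgue. g s) = (LINT s:{a..c}|lebesgue. g s) + (LINT s:{c..b}|lebesgue. g s)"
proof -
  have "{a..b} = {a..c} \<union> {c..b}"
    using assms(2,3) by auto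
  moreover have "AE s in lebesgue. \<not> (s \<in> {a..c} \<and> s \<in> {c..b})"
  proof (rule AE_I[of _ _ "{c}"])
    show "{s \<in> space lebesgue. \<not> \<not> (s \<in> {a..c} \<and> s \<in> {c..b})} \<subseteq> {c}"
      by auto
  qed auto
  ultimately show ?thesis
    using assms by (auto intro!: set_integral_Un_AE intro: set_integrable_subset)
qed

text \<open>The set \<open>E\<close> that carries the integrand is kept apart from the domain
  \<open>A\<close> of integration. For a control vanishing off \<open>E\<close> this gives bounds
  independent of the horizon, and a null set \<open>E\<close> gives a vanishing integral.\<close>

lemma set_integral_norm_le_measure:
  fixes g :: "'a \<Rightarrow> 'b::{banach, second_countable_topology}"
  assumes E: "E \<in> sets M" "emeasure M E < \<infinity>" and C: "0 \<le> C"
    and bound: "AE s in M. s \<in> A \<longrightarrow> norm (g s) \<le> C * indicator E s"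
  shows "norm (LINT s:A|M. g s) \<le> C * measure M E"
proof -
  have "norm (LINT s:A|M. g s) \<le> (LINT s|M. norm (indicat_real A s *\<^sub>R g s))"
    unfolding set_lebesgue_integral_def by (rule integral_norm_bound)
  also have "\<dots> \<le> (LINT s|M. C * indicator E s)"
  proof (rule integral_mono_AE')
    show "AE s in M. norm (indicat_real A s *\<^sub>R g s) \<le> C * indicator E s"
      using bound by eventually_elim (use C in \<open>auto split: split_indicator\<close>)
  qed (use E C in auto)
  also have "\<dots> = C * measure M E"
    using E by simp
  finally show ?thesis .
qed

lemma set_integral_Icc_norm_le:
  fixes g :: "real \<Rightarrow> 'a::{banach, second_countable_topology}"
  assumes "a \<le> b" "0 \<le> C" "\<And>s. s \<in> {a..b} \<Longrightarrow> norm (g s) \<le> C"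
  shows "norm (LINT s:{a..b}|lebesgue. g s) \<le> C * (b - a)"
  using set_integral_norm_le_measure[of "{a..b}" lebesgue C "{a..b}" g] assms
  by (simp add: emeasure_lborel_Icc_eq)

lemma continuous_on_indefinite_integral:
  fixes g :: "real \<Rightarrow> 'a::{banach, second_countable_topology}"
  assumes int: "set_integrable lebesgue {0..T} g"
    and C: "0 \<le> C" "\<And>s. s \<in> {0..T} \<Longrightarrow> norm (g s) \<le> C"
  shows "continuous_on {0..T} (\<lambda>t. LINT s:{0..t}|lebesgue. g s)"
proof -
  have le: "norm ((LINT s:{0..t}|lebesgue. g s) - (LINT s:{0..r}|lebesgue. g s)) \<le> C * (t - r)"
    if "0 \<le> r" "r \<le> t" "t \<le> T" for r t
  proof -
    have "set_integrable lebesgue {0..t} g"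
      by (rule set_integrable_subset[OF int]) (use that in auto)
    then have "(LINT s:{0..t}|lebesgue. g s) - (LINT s:{0..r}|lebesgue. g s) = (LINT s:{r..t}|lebesgue. g s)"
      using that by (simp add: set_integral_Icc_combine[of 0 t g r])
    then show ?thesis
      using that C by (auto intro!: set_integral_Icc_norm_le)
  qed
  have "dist (LINT s:{0..t}|lebesgue. g s) (LINT s:{0..r}|lebesgue. g s) \<le> C * dist t r"
    if "t \<in> {0..T}" "r \<in> {0..T}" for r t
    using that le[of r t] le[of t r]
    by (cases "r \<le> t") (auto simp: dist_norm norm_minus_commute abs_if)
  then have "C-lipschitz_on {0..T} (\<lambda>t. LINT s:{0..t}|lebesgue. g s)"
    using C(1) by (intro lipschitz_onI) auto
  then show ?thesis
    by (rule lipschitz_on_continuous_on)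
qed

locale contraction_semigroup =
  fixes S :: "real \<Rightarrow> 'a::{chilbert_space, second_countable_topology} \<Rightarrow> 'a"
  assumes C0: "C0_semigroup S"
    and contraction: "0 \<le> t \<Longrightarrow> norm (S t x) \<le> norm x"
begin

lemma linear: "0 \<le> t \<Longrightarrow> bounded_linear (S t)"
  by (rule C0_semigroupD(1)[OF C0])

lemma semigroup: "0 \<le> s \<Longrightarrow> 0 \<le> t \<Longrightarrow> S (s + t) x = S s (S t x)"
  by (rule C0_semigroupD(3)[OF C0])

text \<open>\<open>S t\<close> is arbitrary for negative \<open>t\<close>, hence the truncation at 0.\<close>
lemma continuous_orbit: "continuous_on UNIV (\<lambda>t. S (max 0 t) x)"
proof -
  have "isCont (\<lambda>t. S (max 0 t) x) r" for r
  proof -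
    have "continuous_on {..\<bar>r\<bar> + 1} (\<lambda>t. S (max 0 t) x)"
      by (rule continuous_on_compose2[OF C0_semigroup_continuous[OF C0, of "\<bar>r\<bar> + 1"]])
        (auto intro!: continuous_intros)
    then show ?thesis
      by (rule continuous_on_interior) auto
  qed
  then show ?thesis
    by (simp add: continuous_at_imp_continuous_on)
qed

text \<open>Contractivity is uniform in time, so continuity of single orbits suffices. The joint
  statement is what makes convolution integrands measurable.\<close>

lemma jointly_continuous: "continuous_on UNIV (\<lambda>p. S (max 0 (fst p)) (snd p))"
  unfolding continuous_on_def
proof (intro ballI)
  fix p :: "real \<times> 'a"
  let ?S = "\<lambda>t. S (max 0 t)"
  let ?d = "\<lambda>q. dist (snd q) (snd p) + dist (?S (fst q) (snd p)) (?S (fst p) (snd p))"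
  have "isCont (\<lambda>t. ?S t (snd p)) (fst p)"
    using continuous_orbit by (simp add: continuous_on_eq_continuous_at)
  then have "((\<lambda>q. ?S (fst q) (snd p)) \<longlongrightarrow> ?S (fst p) (snd p)) (at p)"
    by (rule isCont_tendsto_compose) (intro tendsto_intros)
  then have "(?d \<longlongrightarrow> dist (snd p) (snd p) + dist (?S (fst p) (snd p)) (?S (fst p) (snd p))) (at p)"
    by (intro tendsto_intros)
  then have "(?d \<longlongrightarrow> 0) (at p)"
    by simp
  moreover have "dist (?S (fst q) (snd q)) (?S (fst p) (snd p)) \<le> ?d q" for q
  proof -
    have "dist (?S (fst q) (snd q)) (?S (fst q) (snd p)) \<le> dist (snd q) (snd p)"
      using contraction[of "max 0 (fst q)" "snd q - snd p"] linear[of "max 0 (fst q)"]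
      by (simp add: dist_norm linear_simps)
    then show ?thesis
      using dist_triangle[of "?S (fst q) (snd q)" "?S (fst p) (snd p)" "?S (fst q) (snd p)"]
      by linarith
  qed
  ultimately show "((\<lambda>q. ?S (fst q) (snd q)) \<longlongrightarrow> ?S (fst p) (snd p)) (at p within UNIV)"
    by (auto intro: metric_tendsto_imp_tendsto[where f = ?d and a = 0] simp: dist_real_def)
qed

end

text \<open>In \<open>equicontinuous\<close> one \<open>d\<close> serves all \<open>s\<close>. This
  replaces smoothness of the forcing, in time and with respect to the generator, and comes from
  forcing values in a compact set.\<close>

locale forced_contraction_semigroup = contraction_semigroup S
  for S :: "real \<Rightarrow> 'a::{chilbert_space, second_countable_topology} \<Rightarrow> 'a" +
  fixes f :: "real \<Rightarrow> 'a" and K :: real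
  assumes f_meas: "f \<in> borel_measurable lebesgue"
    and f_le: "norm (f s) \<le> K"
    and equicontinuous: "0 < e \<Longrightarrow> \<exists>d>0. \<forall>h s. 0 \<le> h \<and> h < d \<longrightarrow> norm (S h (f s) - f s) \<le> e"
begin

lemma K_nonneg: "0 \<le> K"
  using f_le[of 0] norm_ge_zero[of "f 0"] by linarith

lemma S_f_le: "0 \<le> h \<Longrightarrow> norm (S h (f s)) \<le> K"
  using contraction[of h "f s"] f_le[of s] by simp

lemma convolution_integrable:
  assumes "b \<le> t"
  shows "set_integrable lebesgue {a..b} (\<lambda>s. S (t - s) (f s))"
proof -
  have "set_integrable lebesgue {a..b} (\<lambda>s. S (max 0 (t - s)) (f s))"
  proof (rule set_integrable_bounded)
    have "(\<lambda>s. t - s) \<in> borel_measurable lebesgue"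
      by (intro measurable_completion) auto
    then show "(\<lambda>s. S (max 0 (t - s)) (f s)) \<in> borel_measurable lebesgue"
      by (rule borel_measurable_continuous_Pair[OF _ f_meas jointly_continuous])
    show "norm (S (max 0 (t - s)) (f s)) \<le> K" for s
      by (rule S_f_le) simp
  qed
  then show ?thesis
    by (rule set_integrable_cong[THEN iffD1, rotated -1]) (use assms in auto)
qed

definition traj :: "'a \<Rightarrow> real \<Rightarrow> 'a"
  where "traj x0 t = S t x0 + (LINT s:{0..t}|lebesgue. S (t - s) (f s))"

lemma convolution_shift:
  assumes "0 \<le> t" "0 \<le> h"
  shows "S h (LINT s:{0..t}|lebesgue. S (t - s) (f s)) = (LINT s:{0..t}|lebesgue. S (t + h - s) (f s))"
proof -
  have "S h (LINT s:{0..t}|lebesgue. S (t - s) (f s))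
      = (LINT s|lebesgue. S h (indicat_real {0..t} s *\<^sub>R S (t - s) (f s)))"
    unfolding set_lebesgue_integral_def
    using convolution_integrable[of t t 0]
    by (subst integral_bounded_linear[OF linear[OF assms(2)]]) (auto simp: set_integrable_def)
  also have "\<dots> = (LINT s:{0..t}|lebesgue. S (t + h - s) (f s))"
    unfolding set_lebesgue_integral_def
  proof (rule Bochner_Integration.integral_cong[OF refl])
    fix s
    show "S h (indicat_real {0..t} s *\<^sub>R S (t - s) (f s)) = indicat_real {0..t} s *\<^sub>R S (t + h - s) (f s)"
      using semigroup[of h "t - s" "f s"] assms linear[OF assms(2)]
      by (auto simp: linear_simps algebra_simps split: split_indicator)
  qed
  finally show ?thesis .
qed

text \<open>The semigroup law carries the convolution over the past along with the state, so a mild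
  solution can be restarted at any time.\<close>

lemma traj_step:
  assumes "0 \<le> t" "0 \<le> h"
  shows "traj x0 (t + h) = S h (traj x0 t) + (LINT s:{t..t + h}|lebesgue. S (t + h - s) (f s))"
proof -
  have "traj x0 (t + h) = S (h + t) x0 + ((LINT s:{0..t}|lebesgue. S (t + h - s) (f s))
      + (LINT s:{t..t + h}|lebesgue. S (t + h - s) (f s)))"
    unfolding traj_def using assms convolution_integrable[of "t + h" "t + h" 0]
    by (subst set_integral_Icc_combine[of 0 "t + h" _ t]) (auto simp: add.commute)
  also have "\<dots> = S h (traj x0 t) + (LINT s:{t..t + h}|lebesgue. S (t + h - s) (f s))"
    unfolding traj_def using assms linear[OF assms(2)]
    by (simp add: semigroup convolution_shift linear_simps)
  finally show ?thesis .
qed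

lemma traj_0: "traj x0 0 = x0"
proof -
  have "norm (LINT s:{0..0}|lebesgue. S (0 - s) (f s)) \<le> K * (0 - 0)"
    by (rule set_integral_Icc_norm_le) (use K_nonneg S_f_le in auto)
  then show ?thesis
    using C0_semigroupD(2)[OF C0] by (simp add: traj_def)
qed

lemma step_integral_le:
  assumes "0 \<le> h"
  shows "norm (LINT s:{t..t + h}|lebesgue. S (t + h - s) (f s)) \<le> K * h"
  using set_integral_Icc_norm_le[of t "t + h" K "\<lambda>s. S (t + h - s) (f s)"] assms K_nonneg S_f_le
  by auto

lemma traj_uniformly_continuous:
  assumes "0 < e"
  shows "\<exists>d>0. \<forall>t h. 0 \<le> t \<and> t + h \<le> T \<and> 0 \<le> h \<and> h < d \<longrightarrow> norm (traj x0 (t + h) - traj x0 t) \<le> e"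
proof (cases "0 \<le> T")
  case False
  then show ?thesis
    by (intro exI[of _ 1]) auto
next
  case T: True
  \<comment> \<open>An increment splits into the free orbit of \<open>x0\<close>, the shifted
    convolution over the past and the new piece, bounded by \<open>\<eta>\<close>,
    \<open>\<eta> * t\<close> and \<open>K * h\<close> with \<open>h < \<eta>\<close>; together they
    stay below \<open>e\<close>.\<close>
  define \<eta> where "\<eta> = e / (1 + T + K)"
  have \<eta>: "0 < \<eta>" "\<eta> * (1 + T + K) = e"
    using assms T K_nonneg by (auto simp: \<eta>_def)
  obtain d1 where d1: "0 < d1" "\<And>h. 0 \<le> h \<Longrightarrow> h < d1 \<Longrightarrow> norm (S h x0 - x0) < \<eta>"
    using C0_semigroup_near_0[OF C0 \<eta>(1)] by blast
  obtain d2 where d2: "0 < d2" "\<And>h s. 0 \<le> h \<Longrightarrow> h < d2 \<Longrightarrow> norm (S h (f s) - f s) \<le> \<eta>"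
    using equicontinuous[OF \<eta>(1)] by blast
  have "norm (traj x0 (t + h) - traj x0 t) \<le> e"
    if t: "0 \<le> t" "t + h \<le> T" and h: "0 \<le> h" "h < min (min d1 d2) \<eta>" for t h
  proof -
    let ?I = "\<lambda>h. LINT s:{0..t}|lebesgue. S (t + h - s) (f s)"
    have "traj x0 (t + h) - traj x0 t = (S (t + h) x0 - S t x0) + (?I h - ?I 0)
        + (LINT s:{t..t + h}|lebesgue. S (t + h - s) (f s))"
      using traj_step[OF t(1) h(1), of x0] convolution_shift[OF t(1) h(1)]
        semigroup[OF h(1) t(1), of x0] linear[OF h(1)]
      by (simp add: traj_def linear_simps add.commute)
    also have "norm \<dots> \<le> \<eta> + \<eta> * t + K * h"
    proof (intro norm_triangle_le add_mono step_integral_le h(1))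
      have "S (t + h) x0 - S t x0 = S t (S h x0 - x0)"
        using semigroup[OF t(1) h(1), of x0] linear[OF t(1)] by (simp add: linear_simps)
      then show "norm (S (t + h) x0 - S t x0) \<le> \<eta>"
        using contraction[OF t(1), of "S h x0 - x0"] d1(2)[of h] h by simp
      have "?I h - ?I 0 = (LINT s:{0..t}|lebesgue. S (t + h - s) (f s) - S (t - s) (f s))"
        using convolution_integrable[of t t 0] convolution_integrable[of t "t + h" 0] h by simp
      also have "norm \<dots> \<le> \<eta> * (t - 0)"
      proof (rule set_integral_Icc_norm_le)
        fix s assume s: "s \<in> {0..t}"
        then have "S (t + h - s) (f s) - S (t - s) (f s) = S (t - s) (S h (f s) - f s)"
          using semigroup[of "t - s" h "f s"] h linear[of "t - s"] by (simp add: linear_simps algebra_simps)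
        then show "norm (S (t + h - s) (f s) - S (t - s) (f s)) \<le> \<eta>"
          using contraction[of "t - s" "S h (f s) - f s"] d2(2)[of h s] h s by simp
      qed (use t \<eta> in auto)
      finally show "norm (?I h - ?I 0) \<le> \<eta> * t"
        by simp
    qed
    also have "\<dots> \<le> \<eta> + \<eta> * T + K * \<eta>"
      using t h \<eta>(1) K_nonneg by (intro add_mono mult_left_mono) auto
    also have "\<dots> = e"
      using \<eta>(2) by (simp add: algebra_simps)
    finally show ?thesis .
  qed
  then show ?thesis
    using d1(1) d2(1) \<eta>(1) by (intro exI[of _ "min (min d1 d2) \<eta>"]) auto
qed

lemma traj_continuous: "continuous_on {0..T} (traj x0)"
  unfolding continuous_on_iff
proof (intro ballI allI impI)
  fix t e :: real assume t: "t \<in> {0..T}" and e: "0 < e"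
  obtain d where d: "0 < d" "\<And>t h. 0 \<le> t \<Longrightarrow> t + h \<le> T \<Longrightarrow> 0 \<le> h \<Longrightarrow> h < d \<Longrightarrow>
      norm (traj x0 (t + h) - traj x0 t) \<le> e / 2"
    using traj_uniformly_continuous[of "e / 2" T x0] e by auto
  have "dist (traj x0 s) (traj x0 t) < e" if "s \<in> {0..T}" "dist s t < d" for s
    using d(2)[of t "s - t"] d(2)[of s "t - s"] that t e
    by (cases "t \<le> s") (auto simp: dist_norm norm_minus_commute)
  with d(1) show "\<exists>d>0. \<forall>s\<in>{0..T}. dist s t < d \<longrightarrow> dist (traj x0 s) (traj x0 t) < e"
    by blast
qed

lemma traj_measurable: "(\<lambda>s. traj x0 (max 0 s)) \<in> borel_measurable lebesgue"
proof -
  have "isCont (\<lambda>s. traj x0 (max 0 s)) r" for r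
  proof -
    have "continuous_on {..\<bar>r\<bar> + 1} (\<lambda>s. traj x0 (max 0 s))"
      by (rule continuous_on_compose2[OF traj_continuous[of "\<bar>r\<bar> + 1"]])
        (auto intro!: continuous_intros)
    then show ?thesis
      by (rule continuous_on_interior) auto
  qed
  then have "continuous_on UNIV (\<lambda>s. traj x0 (max 0 s))"
    by (simp add: continuous_at_imp_continuous_on)
  then show ?thesis
    by (intro measurable_completion) (simp add: borel_measurable_continuous_onI)
qed

end

section \<open>Energy inequality for mild solutions\<close>

text \<open>Dissipativity is stated for orbits instead of the generator, since states of a mild
  solution may lie outside its domain.\<close>

locale dissipative_semigroup = contraction_semigroup S
  for S :: "real \<Rightarrow> 'a::{chilbert_space, second_countable_topology} \<Rightarrow> 'a" +
  fixes \<delta> :: real and V :: "'a set"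
  assumes \<delta>_pos: "0 < \<delta>"
    and decay: "0 \<le> h \<Longrightarrow> 0 \<le> r \<Longrightarrow> (\<And>t. 0 \<le> t \<Longrightarrow> t \<le> h \<Longrightarrow> r \<le> infdist (S t x) V)
      \<Longrightarrow> (norm (S h x))\<^sup>2 / 2 + \<delta> * h * r\<^sup>2 \<le> (norm x)\<^sup>2 / 2"

locale forced_dissipative_semigroup = dissipative_semigroup S \<delta> V + forced_contraction_semigroup S f K
  for S :: "real \<Rightarrow> 'a::{chilbert_space, second_countable_topology} \<Rightarrow> 'a" and \<delta> V f K
begin

text \<open>Formally the energy has derivative at most the negative of this quantity, so the energy
  plus its integral should be nonincreasing.\<close>

definition dissipation_gap :: "'a \<Rightarrow> real \<Rightarrow> real"
  where "dissipation_gap x0 s = \<delta> * (infdist (traj x0 s) V)\<^sup>2 - inner (f s) (traj x0 s)"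

lemma infdist_traj_integrable:
  "set_integrable lebesgue {0..T} (\<lambda>s. (infdist (traj x0 s) V)\<^sup>2)"
  and supply_integrable: "set_integrable lebesgue {0..T} (\<lambda>s. inner (f s) (traj x0 s))"
  and dissipation_gap_bounded: "\<exists>C\<ge>0. \<forall>s\<in>{0..T}. norm (dissipation_gap x0 s) \<le> C"
proof -
  have cont: "continuous_on {0..T} (\<lambda>s. (infdist (traj x0 s) V)\<^sup>2)"
    by (intro continuous_intros traj_continuous)
  have "bounded (traj x0 ` {0..T})" "bounded ((\<lambda>s. (infdist (traj x0 s) V)\<^sup>2) ` {0..T})"
    using compact_continuous_image[OF traj_continuous compact_Icc]
      compact_continuous_image[OF cont compact_Icc] by (auto intro: compact_imp_bounded)
  then obtain C1 C2 where C1: "\<And>s. s \<in> {0..T} \<Longrightarrow> norm (traj x0 s) \<le> C1"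
    and C2: "\<And>s. s \<in> {0..T} \<Longrightarrow> norm ((infdist (traj x0 s) V)\<^sup>2) \<le> C2"
    unfolding bounded_iff by blast
  have inner_le: "norm (inner (f s) (traj x0 s)) \<le> K * C1" if "s \<in> {0..T}" for s
    using Cauchy_Schwarz_ineq2[of "f s" "traj x0 s"] mult_mono[OF f_le[of s] C1[OF that] K_nonneg]
    by simp
  have meas: "(\<lambda>s. traj x0 (max 0 s)) \<in> borel_measurable lebesgue"
    by (rule traj_measurable)
  have "set_integrable lebesgue {0..T} (\<lambda>s. (infdist (traj x0 (max 0 s)) V)\<^sup>2)"
  proof (rule set_integrable_bounded[where C = C2])
    have "(\<lambda>y. (infdist y V)\<^sup>2) \<in> borel_measurable borel"
      by (intro borel_measurable_continuous_onI continuous_intros)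
    then show "(\<lambda>s. (infdist (traj x0 (max 0 s)) V)\<^sup>2) \<in> borel_measurable lebesgue"
      using measurable_compose[OF meas] by blast
  qed (use C2 in auto)
  then show "set_integrable lebesgue {0..T} (\<lambda>s. (infdist (traj x0 s) V)\<^sup>2)"
    by (rule set_integrable_cong[THEN iffD1, rotated -1]) auto
  have "set_integrable lebesgue {0..T} (\<lambda>s. inner (f s) (traj x0 (max 0 s)))"
    by (rule set_integrable_bounded[where C = "K * C1"])
      (use inner_le f_meas meas in \<open>auto intro: borel_measurable_inner\<close>)
  then show "set_integrable lebesgue {0..T} (\<lambda>s. inner (f s) (traj x0 s))"
    by (rule set_integrable_cong[THEN iffD1, rotated -1]) auto
  have "norm (dissipation_gap x0 s) \<le> \<bar>\<delta>\<bar> * \<bar>C2\<bar> + \<bar>K * C1\<bar>" if "s \<in> {0..T}" for s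
  proof -
    have "norm (dissipation_gap x0 s) \<le> \<bar>\<delta> * (infdist (traj x0 s) V)\<^sup>2\<bar> + \<bar>inner (f s) (traj x0 s)\<bar>"
      by (simp add: dissipation_gap_def)
    also have "\<dots> \<le> \<bar>\<delta>\<bar> * \<bar>C2\<bar> + \<bar>K * C1\<bar>"
      using inner_le[OF that] C2[OF that]
      unfolding abs_mult[of \<delta>] by (intro add_mono mult_left_mono) auto
    finally show ?thesis .
  qed
  then show "\<exists>C\<ge>0. \<forall>s\<in>{0..T}. norm (dissipation_gap x0 s) \<le> C"
    by (intro exI[of _ "\<bar>\<delta>\<bar> * \<bar>C2\<bar> + \<bar>K * C1\<bar>"]) auto
qed

lemma dissipation_gap_integrable: "set_integrable lebesgue {0..T} (dissipation_gap x0)"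
  unfolding dissipation_gap_def
  by (intro set_integral_diff set_integrable_mult_right infdist_traj_integrable supply_integrable)

text \<open>The new state is \<open>S h z + W\<close>, with \<open>W\<close> the contribution of the
  forcing. Expanding the square, free decay supplies the dissipation, the scalar product of
  \<open>z\<close> and \<open>W\<close> matches the supplied energy, and all remaining terms are of
  size \<eta> h.\<close>

lemma energy_step:
  assumes t: "0 \<le> t" and h: "0 \<le> h" "h \<le> \<eta>" and \<eta>: "0 < \<eta>" "\<eta> \<le> 1"
    and S_z: "\<And>\<tau>. 0 \<le> \<tau> \<Longrightarrow> \<tau> \<le> h \<Longrightarrow> norm (S \<tau> (traj x0 t) - traj x0 t) \<le> \<eta>"
    and S_f: "\<And>\<tau> s. 0 \<le> \<tau> \<Longrightarrow> \<tau> \<le> h \<Longrightarrow> norm (S \<tau> (f s) - f s) \<le> \<eta>"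
    and near: "\<And>s. s \<in> {t..t + h} \<Longrightarrow> norm (traj x0 s - traj x0 t) \<le> \<eta>"
  shows "(norm (traj x0 (t + h)))\<^sup>2 / 2 + (LINT s:{t..t + h}|lebesgue. dissipation_gap x0 s)
    \<le> (norm (traj x0 t))\<^sup>2 / 2
      + \<eta> * (\<delta> * (4 * infdist (traj x0 t) V + 1) + 2 * K + norm (traj x0 t) + K\<^sup>2 / 2) * h"
proof -
  define z where "z = traj x0 t"
  define D where "D = infdist z V"
  define r where "r = max 0 (D - \<eta>)"
  let ?c = "\<lambda>s. S (t + h - s) (f s)"
  define W where "W = (LINT s:{t..t + h}|lebesgue. ?c s)"
  have D: "0 \<le> D"
    by (simp add: D_def infdist_nonneg)
  have Wle: "norm W \<le> K * h"
    unfolding W_def by (rule step_integral_le[OF h(1)])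
  have "(norm (S h z))\<^sup>2 / 2 + \<delta> * h * r\<^sup>2 \<le> (norm z)\<^sup>2 / 2"
  proof (rule decay[OF h(1)])
    fix \<tau> assume "0 \<le> \<tau>" "\<tau> \<le> h"
    from S_z[OF this] show "r \<le> infdist (S \<tau> z) V"
      using infdist_triangle[of z V "S \<tau> z"] infdist_nonneg[of "S \<tau> z" V]
      by (auto simp: r_def D_def z_def dist_norm norm_minus_commute)
  qed (simp add: r_def)
  \<comment> \<open>The loss is of first order in \<open>\<eta>\<close>; when \<open>\<eta>\<close>
    exceeds \<open>D\<close>, the left side is already nonpositive.\<close>
  moreover have "D\<^sup>2 - 2 * \<eta> * D \<le> r\<^sup>2"
  proof (cases "\<eta> \<le> D")
    case True
    then have "r\<^sup>2 = D\<^sup>2 - 2 * \<eta> * D + \<eta>\<^sup>2"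
      by (simp add: r_def power2_diff)
    then show ?thesis
      by simp
  next
    case False
    then have "D * D \<le> 2 * \<eta> * D"
      using D \<eta> by (intro mult_right_mono) auto
    then have "D\<^sup>2 - 2 * \<eta> * D \<le> 0"
      by (simp add: power2_eq_square)
    also have "0 \<le> r\<^sup>2"
      by simp
    finally show ?thesis .
  qed
  then have "\<delta> * h * (D\<^sup>2 - 2 * \<eta> * D) \<le> \<delta> * h * r\<^sup>2"
    using \<delta>_pos h by (intro mult_left_mono) auto
  ultimately have decay: "(norm (S h z))\<^sup>2 / 2 + \<delta> * h * (D\<^sup>2 - 2 * \<eta> * D) \<le> (norm z)\<^sup>2 / 2"
    by linarith
  \<comment> \<open>Replacing \<open>S h z\<close> by \<open>z\<close> in the cross term costs only
    \<open>\<eta>\<close> times \<open>norm W\<close>.\<close>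
  have "inner (S h z - z) W \<le> \<eta> * (K * h)"
    using norm_cauchy_schwarz[of "S h z - z" W] mult_mono[OF S_z[OF h(1) order_refl] Wle] \<eta>
    by (simp add: z_def)
  then have cross: "inner (S h z) W \<le> inner z W + \<eta> * K * h"
    by (simp add: inner_diff_left)
  \<comment> \<open>This term is quadratic in \<open>h\<close>; the assumption
    \<open>h \<le> \<eta>\<close> trades one factor \<open>h\<close> for
    \<open>\<eta>\<close>.\<close>
  have W2: "(norm W)\<^sup>2 \<le> \<eta> * K\<^sup>2 * h"
  proof -
    have "(norm W)\<^sup>2 \<le> (K * h)\<^sup>2"
      using Wle by (intro power_mono) auto
    also have "\<dots> = h * (K\<^sup>2 * h)"
      by (simp add: power2_eq_square)
    also have "\<dots> \<le> \<eta> * (K\<^sup>2 * h)"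
      using h by (intro mult_right_mono) auto
    finally show ?thesis
      by (simp add: mult.assoc)
  qed
  have c_int: "set_integrable lebesgue {t..t + h} ?c"
    by (rule convolution_integrable) simp
  have g_int: "set_integrable lebesgue {t..t + h} (dissipation_gap x0)"
    by (rule set_integrable_subset[OF dissipation_gap_integrable[of "t + h"]]) (use t in auto)
  have zc_int: "set_integrable lebesgue {t..t + h} (\<lambda>s. inner z (?c s))"
    using c_int integrable_inner_right[of z lebesgue "\<lambda>s. indicat_real {t..t + h} s *\<^sub>R ?c s"]
    by (simp add: set_integrable_def)
  have zW: "inner z W = (LINT s:{t..t + h}|lebesgue. inner z (?c s))"
    using c_int integral_inner_right[of z lebesgue "\<lambda>s. indicat_real {t..t + h} s *\<^sub>R ?c s"]
    by (simp add: W_def set_lebesgue_integral_def set_integrable_def)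
  \<comment> \<open>The summands account for replacing the propagated forcing by \<open>f s\<close>,
    for freezing the state at \<open>z\<close>, and for the largest distance reached during the
    step.\<close>
  let ?M = "norm z * \<eta> + K * \<eta> + \<delta> * (D + \<eta>)\<^sup>2"
  have "inner z W + (LINT s:{t..t + h}|lebesgue. dissipation_gap x0 s)
      = (LINT s:{t..t + h}|lebesgue. inner z (?c s) + dissipation_gap x0 s)"
    using zc_int g_int by (simp add: zW)
  also have "\<dots> \<le> (LINT s:{t..t + h}|lebesgue. ?M)"
  proof (rule set_integral_mono)
    show "set_integrable lebesgue {t..t + h} (\<lambda>s. inner z (?c s) + dissipation_gap x0 s)"
      using zc_int g_int by (rule set_integral_add)
    show "set_integrable lebesgue {t..t + h} (\<lambda>s. ?M)"
      by (rule set_integrable_bounded[where C = ?M]) (use \<eta> \<delta>_pos K_nonneg in auto)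
    fix s assume s: "s \<in> {t..t + h}"
    have "inner z (?c s) - inner (f s) (traj x0 s) = inner z (?c s - f s) + inner (f s) (z - traj x0 s)"
      by (simp add: inner_diff_right inner_commute)
    also have "\<dots> \<le> norm z * \<eta> + K * \<eta>"
    proof (intro add_mono order_trans[OF norm_cauchy_schwarz] mult_mono)
      show "norm (?c s - f s) \<le> \<eta>"
        using S_f[of "t + h - s" s] s by auto
      show "norm (z - traj x0 s) \<le> \<eta>"
        using near[OF s] by (simp add: z_def norm_minus_commute)
    qed (use f_le K_nonneg \<eta> in auto)
    finally have "inner z (?c s) - inner (f s) (traj x0 s) \<le> norm z * \<eta> + K * \<eta>" .
    moreover have "infdist (traj x0 s) V \<le> D + \<eta>"
      using infdist_triangle[of "traj x0 s" V z] near[OF s] by (simp add: D_def z_def dist_norm)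
    then have "\<delta> * (infdist (traj x0 s) V)\<^sup>2 \<le> \<delta> * (D + \<eta>)\<^sup>2"
      using \<delta>_pos by (intro mult_left_mono power_mono) (auto simp: infdist_nonneg)
    ultimately show "inner z (?c s) + dissipation_gap x0 s \<le> ?M"
      by (simp add: dissipation_gap_def)
  qed
  also have "\<dots> = h * ?M"
    using h by (subst set_integral_const) auto
  finally have rate: "inner z W + (LINT s:{t..t + h}|lebesgue. dissipation_gap x0 s) \<le> h * ?M" .
  have "(norm (traj x0 (t + h)))\<^sup>2 / 2 = (norm (S h z))\<^sup>2 / 2 + inner (S h z) W + (norm W)\<^sup>2 / 2"
  proof -
    have "traj x0 (t + h) = S h z + W"
      using traj_step[OF t h(1)] by (simp add: z_def W_def)
    then show ?thesis
      using dot_norm[of "S h z" W] by (simp add: field_simps)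
  qed
  with decay cross W2 rate
  have "(norm (traj x0 (t + h)))\<^sup>2 / 2 + (LINT s:{t..t + h}|lebesgue. dissipation_gap x0 s)
      \<le> (norm z)\<^sup>2 / 2 - \<delta> * h * (D\<^sup>2 - 2 * \<eta> * D) + \<eta> * K * h + \<eta> * K\<^sup>2 * h / 2 + h * ?M"
    by linarith
  \<comment> \<open>The factor 4 arises from (D + \<eta>)^2 - (D^2 - 2 \<eta> D) = \<eta> (4 D +
    \<eta>).\<close>
  also have "\<dots> = (norm z)\<^sup>2 / 2 + \<eta> * (\<delta> * (4 * D + \<eta>) + 2 * K + norm z + K\<^sup>2 / 2) * h"
    by (simp add: power2_eq_square field_simps)
  also have "\<dots> \<le> (norm z)\<^sup>2 / 2 + \<eta> * (\<delta> * (4 * D + 1) + 2 * K + norm z + K\<^sup>2 / 2) * h"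
    using \<eta> h \<delta>_pos by (intro add_mono mult_right_mono mult_left_mono) auto
  finally show ?thesis
    by (simp add: z_def D_def)
qed

text \<open>The single steps give a nonpositive right Dini derivative for the energy plus the
  accumulated gap, which is continuous although the trajectory need not be differentiable.\<close>

lemma energy_inequality:
  assumes T: "0 \<le> T"
  shows "\<delta> * (LINT s:{0..T}|lebesgue. (infdist (traj x0 s) V)\<^sup>2) + (norm (traj x0 T))\<^sup>2 / 2
    \<le> (norm x0)\<^sup>2 / 2 + (LINT s:{0..T}|lebesgue. inner (f s) (traj x0 s))"
proof -
  let ?G = "\<lambda>t. LINT s:{0..t}|lebesgue. dissipation_gap x0 s"
  define \<psi> where "\<psi> t = (norm (traj x0 t))\<^sup>2 / 2 + ?G t" for t
  obtain C where C: "0 \<le> C" "\<And>s. s \<in> {0..T} \<Longrightarrow> norm (dissipation_gap x0 s) \<le> C"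
    using dissipation_gap_bounded by blast
  have "\<psi> T \<le> \<psi> 0"
  proof (rule nonincreasing_if_right_Dini_nonpos[OF T])
    show "continuous_on {0..T} \<psi>"
      unfolding \<psi>_def using C
      by (intro continuous_intros traj_continuous continuous_on_indefinite_integral
          dissipation_gap_integrable) auto
    fix t e :: real assume t: "0 \<le> t" "t < T" and e: "0 < e"
    let ?R = "\<delta> * (4 * infdist (traj x0 t) V + 1) + 2 * K + norm (traj x0 t) + K\<^sup>2 / 2"
    have R: "0 \<le> ?R"
      using \<delta>_pos K_nonneg by (simp add: infdist_nonneg)
    \<comment> \<open>The bound 1 is required by \<open>energy_step\<close>; the other term makes
      the error rate \<open>\<eta> * ?R\<close> at most \<open>e\<close>.\<close>
    define \<eta> where "\<eta> = min 1 (e / (?R + 1))"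
    have \<eta>: "0 < \<eta>" "\<eta> \<le> 1"
      using e R by (auto simp: \<eta>_def)
    have "\<eta> * ?R \<le> e / (?R + 1) * ?R"
      using R by (intro mult_right_mono) (auto simp: \<eta>_def)
    also have "\<dots> \<le> e"
      using e R by (simp add: divide_simps)
    finally have \<eta>R: "\<eta> * ?R \<le> e" .
    obtain d1 where d1: "0 < d1" "\<And>\<tau>. 0 \<le> \<tau> \<Longrightarrow> \<tau> < d1 \<Longrightarrow> norm (S \<tau> (traj x0 t) - traj x0 t) < \<eta>"
      using C0_semigroup_near_0[OF C0 \<eta>(1)] by blast
    obtain d2 where d2: "0 < d2" "\<And>\<tau> s. 0 \<le> \<tau> \<Longrightarrow> \<tau> < d2 \<Longrightarrow> norm (S \<tau> (f s) - f s) \<le> \<eta>"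
      using equicontinuous[OF \<eta>(1)] by blast
    obtain d3 where d3: "0 < d3" "\<And>h. t + h \<le> T \<Longrightarrow> 0 \<le> h \<Longrightarrow> h < d3 \<Longrightarrow>
        norm (traj x0 (t + h) - traj x0 t) \<le> \<eta>"
      using traj_uniformly_continuous[OF \<eta>(1), of T x0] t(1) by blast
    \<comment> \<open>Including \<open>\<eta>\<close> enforces \<open>h \<le> \<eta>\<close>, and
      \<open>T - t\<close> keeps \<open>t + h\<close> within the horizon.\<close>
    define d where "d = min (min d1 d2) (min (min d3 \<eta>) (T - t))"
    have d: "0 < d"
      using d1(1) d2(1) d3(1) \<eta>(1) t by (simp add: d_def)
    have "\<psi> (t + h) - \<psi> t \<le> e * h" if h: "0 < h" "h < d" for h
    proof -
      have "(norm (traj x0 (t + h)))\<^sup>2 / 2 + (LINT s:{t..t + h}|lebesgue. dissipation_gap x0 s)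
          \<le> (norm (traj x0 t))\<^sup>2 / 2 + \<eta> * ?R * h"
      proof (rule energy_step[OF t(1) _ _ \<eta>])
        show "norm (S \<tau> (traj x0 t) - traj x0 t) \<le> \<eta>" if "0 \<le> \<tau>" "\<tau> \<le> h" for \<tau>
          using d1(2)[of \<tau>] that h by (simp add: d_def)
        show "norm (S \<tau> (f s) - f s) \<le> \<eta>" if "0 \<le> \<tau>" "\<tau> \<le> h" for \<tau> s
          using d2(2)[of \<tau> s] that h by (simp add: d_def)
        show "norm (traj x0 s - traj x0 t) \<le> \<eta>" if "s \<in> {t..t + h}" for s
          using d3(2)[of "s - t"] that h by (simp add: d_def)
      qed (use h in \<open>auto simp: d_def\<close>)
      also have "\<dots> \<le> (norm (traj x0 t))\<^sup>2 / 2 + e * h"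
        using \<eta>R h by (intro add_left_mono mult_right_mono) auto
      finally show ?thesis
        using set_integral_Icc_combine[of 0 "t + h" "dissipation_gap x0" t, OF dissipation_gap_integrable] t h
        by (simp add: \<psi>_def)
    qed
    with d show "\<exists>d>0. \<forall>h. 0 < h \<and> h < d \<longrightarrow> \<psi> (t + h) - \<psi> t \<le> e * h"
      by blast
  qed
  moreover have "?G 0 = 0"
    using set_integral_Icc_norm_le[of 0 0 C "dissipation_gap x0"] C T by auto
  moreover have "?G T = \<delta> * (LINT s:{0..T}|lebesgue. (infdist (traj x0 s) V)\<^sup>2)
      - (LINT s:{0..T}|lebesgue. inner (f s) (traj x0 s))"
    unfolding dissipation_gap_def
    using infdist_traj_integrable supply_integrable by (subst set_integral_diff(2)) auto
  ultimately show ?thesis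
    by (simp add: \<psi>_def traj_0)
qed

end

section \<open>Admissible controls\<close>

text \<open>As \<open>cadjoint\<close> is defined by choice, existence has to be shown; in finite
  dimension the coordinates of the adjoint are conjugated scalar products with the images of the
  unit vectors.\<close>

lemma cinner_cadjoint:
  fixes B :: "complex ^ 'm \<Rightarrow> 'h::complex_inner"
  assumes "bounded_clinear B"
  shows "cinner (B u) y = cinner u (cadjoint B y)"
proof -
  have lin: "linear B" and scale: "\<And>c x. B (c *\<^sub>C x) = c *\<^sub>C B x"
    using assms by (auto simp: bounded_clinear_def bounded_linear.linear)
  define g where "g y = (\<chi> i. cnj (cinner (B (axis i 1)) y))" for y
  have "cinner (B u) y = cinner u (g y)" for u y
  proof -
    have zero: "cinner 0 y = 0"
      using cinner_add_left[of 0 0 y] by simp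
    have "u = (\<Sum>i\<in>UNIV. u $ i *\<^sub>C axis i 1)"
      by (simp add: vec_eq_iff scaleC_vec_def scaleC_complex_def axis_def if_distrib cong: if_cong)
    then have "B u = (\<Sum>i\<in>UNIV. u $ i *\<^sub>C B (axis i 1))"
      using linear_sum[OF lin, of "\<lambda>i. u $ i *\<^sub>C axis i 1" UNIV] by (simp add: scale)
    then have "cinner (B u) y = (\<Sum>i\<in>UNIV. cinner (u $ i *\<^sub>C B (axis i 1)) y)"
      using sum_comp_morphism[of "\<lambda>x. cinner x y" "\<lambda>i. u $ i *\<^sub>C B (axis i 1)" UNIV]
      by (simp add: zero cinner_add_left o_def)
    then show ?thesis
      by (simp add: g_def cinner_vec_def cinner_complex_def cinner_scaleC_left)
  qed
  then have "\<exists>g. \<forall>u y. cinner (B u) y = cinner u (g y)"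
    by blast
  then have "\<forall>u y. cinner (B u) y = cinner u (cadjoint B y)"
    unfolding cadjoint_def by (rule someI_ex)
  then show ?thesis
    by blast
qed

text \<open>Strong continuity is applied to a finite net of radius \<open>e / 3\<close>, and
  contractivity transfers the estimate from the net to all of \<open>C\<close>.\<close>

lemma (in contraction_semigroup) equicontinuous_on_compact:
  assumes C: "compact C" and e: "0 < e"
  shows "\<exists>d>0. \<forall>h b. 0 \<le> h \<and> h < d \<and> b \<in> C \<longrightarrow> norm (S h b - b) \<le> e"
proof -
  have "0 < e / 3"
    using e by simp
  then obtain N where N: "finite N" "C \<subseteq> (\<Union>x\<in>N. ball x (e / 3))"
    using C unfolding compact_eq_totally_bounded by blast
  have "\<forall>x\<in>N. \<exists>d>0. \<forall>h. 0 \<le> h \<and> h < d \<longrightarrow> norm (S h x - x) < e / 3"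
    using C0_semigroup_near_0[OF C0 \<open>0 < e / 3\<close>] by metis
  then obtain D where D: "\<And>x. x \<in> N \<Longrightarrow> 0 < D x"
    "\<And>x h. x \<in> N \<Longrightarrow> 0 \<le> h \<Longrightarrow> h < D x \<Longrightarrow> norm (S h x - x) < e / 3"
    by metis
  \<comment> \<open>Inserting 1 gives the minimum a meaning for an empty net.\<close>
  define d where "d = Min (insert 1 (D ` N))"
  have "0 < d"
    using N(1) D(1) by (auto simp: d_def)
  moreover have "norm (S h b - b) \<le> e" if h: "0 \<le> h" "h < d" and b: "b \<in> C" for h b
  proof -
    obtain x where x: "x \<in> N" "norm (x - b) < e / 3"
      using N(2) b by (auto simp: dist_norm)
    have "d \<le> D x"
      using N(1) x(1) by (auto simp: d_def)
    then have "norm (S h x - x) < e / 3"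
      using D(2)[OF x(1) h(1)] h(2) by simp
    moreover have "norm (S h (b - x)) < e / 3"
      using contraction[OF h(1), of "b - x"] x(2) by (simp add: norm_minus_commute)
    moreover have "S h b - b = S h (b - x) + (S h x - x) + (x - b)"
      using linear[OF h(1)] by (simp add: linear_simps)
    ultimately show ?thesis
      using x(2) norm_triangle_ineq[of "S h (b - x) + (S h x - x)" "x - b"]
        norm_triangle_ineq[of "S h (b - x)" "S h x - x"] by simp
  qed
  ultimately show ?thesis
    by blast
qed

lemma (in contraction_semigroup) convolution_measurable:
  assumes f: "f \<in> borel_measurable lebesgue" and "b \<le> t"
  shows "(\<lambda>s. indicat_real {a..b} s *\<^sub>R S (t - s) (f s)) \<in> borel_measurable lebesgue"
proof -
  have "(\<lambda>s. t - s) \<in> borel_measurable lebesgue"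
    by (intro measurable_completion) auto
  then have "(\<lambda>s. S (max 0 (t - s)) (f s)) \<in> borel_measurable lebesgue"
    by (rule borel_measurable_continuous_Pair[OF _ f jointly_continuous])
  then have "(\<lambda>s. indicat_real {a..b} s *\<^sub>R S (max 0 (t - s)) (f s)) \<in> borel_measurable lebesgue"
    by (intro borel_measurable_scaleR borel_measurable_indicator) auto
  moreover have "indicat_real {a..b} s *\<^sub>R S (max 0 (t - s)) (f s)
      = indicat_real {a..b} s *\<^sub>R S (t - s) (f s)" for s
    using \<open>b \<le> t\<close> by (auto split: split_indicator)
  ultimately show ?thesis
    by simp
qed

text \<open>Measurability is asked of the truncated integrand because convolution integrands involve
  the semigroup at negative, hence arbitrary, times beyond \<open>b\<close>.\<close>

lemma set_lebesgue_integral_shift: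
  fixes g :: "real \<Rightarrow> 'a::{banach, second_countable_topology}"
  assumes "(\<lambda>s. indicat_real {0..b} s *\<^sub>R g s) \<in> borel_measurable lebesgue"
  shows "(LINT s:{a..a + b}|lebesgue. g (s - a)) = (LINT s:{0..b}|lebesgue. g s)"
proof -
  have eq: "lebesgue = distr lebesgue lebesgue (\<lambda>x. - a + 1 * x)"
    using lebesgue_real_affine[of 1 "- a"] by (simp add: density_1)
  have meas: "(\<lambda>x. - a + 1 * x) \<in> lebesgue \<rightarrow>\<^sub>M lebesgue"
    using lebesgue_affine_measurable[where c = "\<lambda>x::real. 1" and t = "- a"] by simp
  let ?g = "\<lambda>s. indicat_real {0..b} s *\<^sub>R g s"
  have "(LINT s|lebesgue. ?g s) = (LINT s|distr lebesgue lebesgue (\<lambda>x. - a + 1 * x). ?g s)"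
    using eq by simp
  also have "\<dots> = (LINT s|lebesgue. ?g (- a + 1 * s))"
    by (rule integral_distr[OF meas assms])
  also have "\<dots> = (LINT s:{a..a + b}|lebesgue. g (s - a))"
    unfolding set_lebesgue_integral_def
    by (intro Bochner_Integration.integral_cong refl) (auto split: split_indicator)
  finally show ?thesis
    by (simp add: set_lebesgue_integral_def)
qed

section \<open>Energy estimate, steering control and turnpike\<close>

locale control_system = dissipative_semigroup S \<delta> V
  for S :: "real \<Rightarrow> 'a::{chilbert_space, second_countable_topology} \<Rightarrow> 'a" and \<delta> V +
  fixes B :: "complex ^ 'm \<Rightarrow> 'a" and U :: "(complex ^ 'm) set" and K :: real
  assumes B: "bounded_clinear B" and U: "compact U" "0 \<in> U"
    and K: "u \<in> U \<Longrightarrow> norm (B u) \<le> K"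
begin

lemma B_continuous: "continuous_on UNIV B"
  using B by (simp add: bounded_clinear_def linear_continuous_on)

lemma B_zero: "B 0 = 0"
  using B linear_simps(3) by (auto simp: bounded_clinear_def)

lemma B_measurable: "v \<in> borel_measurable M \<Longrightarrow> (\<lambda>s. B (v s)) \<in> borel_measurable M"
  using measurable_compose[OF _ borel_measurable_continuous_onI[OF B_continuous]] by blast

lemma forced:
  assumes "v \<in> borel_measurable lebesgue" "\<And>s. v s \<in> U"
  shows "forced_dissipative_semigroup S \<delta> V (\<lambda>s. B (v s)) K"
proof unfold_locales
  fix e :: real assume "0 < e"
  moreover have "compact (B ` U)"
    using U(1) B_continuous by (blast intro: compact_continuous_image continuous_on_subset)
  ultimately obtain d where "0 < d" "\<forall>h b. 0 \<le> h \<and> h < d \<and> b \<in> B ` U \<longrightarrow> norm (S h b - b) \<le> e"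
    using equicontinuous_on_compact by blast
  then show "\<exists>d>0. \<forall>h s. 0 \<le> h \<and> h < d \<longrightarrow> norm (S h (B (v s)) - B (v s)) \<le> e"
    using assms(2) by (intro exI[of _ d]) blast
qed (use assms K B_measurable in auto)

lemma supply_eq: "Re (cinner u (cadjoint B y)) = inner (B u) y"
  by (simp add: cinner_cadjoint[OF B] inner_eq_Re_cinner)

text \<open>An admissible control is measurable on its horizon only and takes values in
  \<open>U\<close> only almost everywhere. Resetting it to 0, a point of \<open>U\<close>, makes
  both properties global without changing any integral.\<close>

lemma admissible_representative:
  assumes u: "u \<in> admissible_controls U T"
  shows "\<exists>v \<in> borel_measurable lebesgue. (\<forall>s. v s \<in> U) \<and>
    (\<forall>x0. \<forall>t\<le>T. mild_solution S B x0 u t = mild_solution S B x0 v t) \<and>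
    (\<forall>x0. supplied_energy S B T x0 u
      = (LINT s:{0..T}|lebesgue. inner (B (v s)) (mild_solution S B x0 v s)))"
proof -
  \<comment> \<open>Two stages: \<open>w\<close> agrees with \<open>u\<close> everywhere on the
    horizon and is measurable on the whole line, so that \<open>v\<close>, equal to \<open>w\<close>
    almost everywhere, can replace it under the integral.\<close>
  define w where "w s = (if s \<in> {0..T} then u s else 0)" for s
  define v where "v s = (if w s \<in> U then w s else 0)" for s
  have w: "w \<in> borel_measurable lebesgue"
    unfolding w_def using u by (intro borel_measurable_if_I) (auto simp: admissible_controls_def)
  have vU: "v s \<in> U" for s
    using U(2) by (simp add: v_def)
  have "(\<lambda>y. if y \<in> U then y else 0) \<in> borel_measurable borel"
    using U(1) by (intro measurable_If_set) (auto intro: borel_closed compact_imp_closed)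
  then have v: "v \<in> borel_measurable lebesgue"
    using measurable_compose[OF w] unfolding v_def by blast
  have "AE s in lebesgue. s \<in> {0..T} \<longrightarrow> u s \<in> U"
    using u by (simp add: admissible_controls_def AE_restrict_space_iff)
  then have vw: "AE s in lebesgue. v s = w s"
    by eventually_elim (use U(2) in \<open>auto simp: v_def w_def\<close>)
  have mild: "mild_solution S B x0 u t = mild_solution S B x0 v t" if t: "t \<le> T" for x0 t
  proof -
    have "(LINT s:{0..t}|lebesgue. S (t - s) (B (u s))) = (LINT s:{0..t}|lebesgue. S (t - s) (B (w s)))"
      using t by (intro set_lebesgue_integral_cong) (auto simp: w_def)
    also have "\<dots> = (LINT s:{0..t}|lebesgue. S (t - s) (B (v s)))"
      unfolding set_lebesgue_integral_def
    proof (rule integral_cong_AE)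
      show "AE s in lebesgue. indicat_real {0..t} s *\<^sub>R S (t - s) (B (w s))
          = indicat_real {0..t} s *\<^sub>R S (t - s) (B (v s))"
        using vw by eventually_elim simp
    qed (auto intro!: convolution_measurable B_measurable v w)
    finally show ?thesis
      by (simp add: mild_solution_def)
  qed
  have "supplied_energy S B T x0 u
      = (LINT s:{0..T}|lebesgue. inner (B (v s)) (mild_solution S B x0 v s))" for x0
  proof -
    interpret f: forced_dissipative_semigroup S \<delta> V "\<lambda>s. B (v s)" K
      by (rule forced[OF v vU])
    have traj: "f.traj x0 = mild_solution S B x0 v"
      by (simp add: fun_eq_iff mild_solution_def f.traj_def)
    let ?x = "\<lambda>s. f.traj x0 (max 0 s)"
    have "supplied_energy S B T x0 u = (LINT s:{0..T}|lebesgue. inner (B (w s)) (?x s))"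
      unfolding supplied_energy_def supply_eq
      by (intro set_lebesgue_integral_cong) (auto simp: w_def mild traj)
    also have "\<dots> = (LINT s:{0..T}|lebesgue. inner (B (v s)) (?x s))"
      unfolding set_lebesgue_integral_def
    proof (rule integral_cong_AE)
      show "AE s in lebesgue. indicat_real {0..T} s *\<^sub>R inner (B (w s)) (?x s)
          = indicat_real {0..T} s *\<^sub>R inner (B (v s)) (?x s)"
        using vw by eventually_elim simp
    qed (auto intro!: borel_measurable_times borel_measurable_indicator borel_measurable_inner
        B_measurable v w f.traj_measurable)
    also have "\<dots> = (LINT s:{0..T}|lebesgue. inner (B (v s)) (mild_solution S B x0 v s))"
      by (intro set_lebesgue_integral_cong) (auto simp: traj)
    finally show ?thesis .
  qed
  with v vU mild show ?thesis
    by (intro bexI[of _ v] conjI allI impI)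
qed

lemma admissible_energy_inequality:
  assumes u: "u \<in> admissible_controls U T" and T: "0 \<le> T"
  shows "\<delta> * (LINT s:{0..T}|lebesgue. (infdist (mild_solution S B x0 u s) V)\<^sup>2)
    \<le> (norm x0)\<^sup>2 / 2 + supplied_energy S B T x0 u"
proof -
  obtain v where v: "v \<in> borel_measurable lebesgue" "\<And>s. v s \<in> U"
    and mild: "\<And>t. t \<le> T \<Longrightarrow> mild_solution S B x0 u t = mild_solution S B x0 v t"
    and energy: "supplied_energy S B T x0 u
      = (LINT s:{0..T}|lebesgue. inner (B (v s)) (mild_solution S B x0 v s))"
    using admissible_representative[OF u] by blast
  interpret f: forced_dissipative_semigroup S \<delta> V "\<lambda>s. B (v s)" K
    by (rule forced[OF v])
  have traj: "f.traj x0 = mild_solution S B x0 v"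
    by (simp add: fun_eq_iff mild_solution_def f.traj_def)
  have "\<delta> * (LINT s:{0..T}|lebesgue. (infdist (mild_solution S B x0 u s) V)\<^sup>2)
      = \<delta> * (LINT s:{0..T}|lebesgue. (infdist (mild_solution S B x0 v s) V)\<^sup>2)"
    by (intro arg_cong[where f = "(*) \<delta>"] set_lebesgue_integral_cong) (auto simp: mild)
  moreover have "0 \<le> (norm (mild_solution S B x0 v T))\<^sup>2 / 2"
    by simp
  ultimately show ?thesis
    using f.energy_inequality[OF T, of x0] unfolding traj energy by linarith
qed

lemma admissible_control:
  assumes "v \<in> borel_measurable lebesgue" "\<And>s. v s \<in> U"
  shows "v \<in> admissible_controls U T"
proof -
  obtain M where M: "\<And>u. u \<in> U \<Longrightarrow> norm u \<le> M"
    using compact_imp_bounded[OF U(1)] by (auto simp: bounded_iff)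
  have meas: "v \<in> borel_measurable (lebesgue_on {0..T})"
    using assms(1) by (rule measurable_restrict_space1)
  have "integrable (lebesgue_on {0..T}) (\<lambda>t. (norm (v t))\<^sup>2)"
  proof (rule finite_measure.integrable_const_bound[where B = "M\<^sup>2"])
    show "finite_measure (lebesgue_on {0..T})"
      by (intro finite_measure_lebesgue_on) simp
    show "AE t in lebesgue_on {0..T}. norm ((norm (v t))\<^sup>2) \<le> M\<^sup>2"
      using M assms(2) by (intro AE_I2) (auto intro: power_mono)
    show "(\<lambda>t. (norm (v t))\<^sup>2) \<in> borel_measurable (lebesgue_on {0..T})"
      by (intro borel_measurable_power measurable_compose[OF meas borel_measurable_norm])
  qed
  then show ?thesis
    using meas assms(2) by (simp add: admissible_controls_def)
qed

text \<open>On the horizon the control vanishes off \<open>E\<close>, so contractivity bounds the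
  state by \<open>norm x0 + K * (T0 + T1)\<close>. The supply rate is at most \<open>K\<close> times
  this on \<open>E\<close> and zero elsewhere; the last factor bounds the measure of
  \<open>E\<close>.\<close>

lemma concatenation:
  assumes u0: "u0 \<in> admissible_controls U T0" "mild_solution S B x0 u0 T0 = 0" "0 \<le> T0"
    and u1: "u1 \<in> admissible_controls U T1" "mild_solution S B 0 u1 T1 = xT" "0 \<le> T1"
    and T: "T0 + T1 < T"
  obtains v where "v \<in> feasible_controls S B U xT T x0"
    "supplied_energy S B T x0 v \<le> K * (norm x0 + K * (T0 + T1)) * (T0 + T1)"
proof -
  obtain v0 where v0: "v0 \<in> borel_measurable lebesgue" "\<And>s. v0 s \<in> U" "mild_solution S B x0 v0 T0 = 0"
    using admissible_representative[OF u0(1)] u0(2) by (metis order_refl)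
  obtain v1 where v1: "v1 \<in> borel_measurable lebesgue" "\<And>s. v1 s \<in> U" "mild_solution S B 0 v1 T1 = xT"
    using admissible_representative[OF u1(1)] u1(2) by (metis order_refl)
  define a where "a = T - T1"
  have a: "T0 < a" "a \<le> T" "T = a + T1"
    using T u1(3) by (auto simp: a_def)
  define E where "E = {0..T0} \<union> {a..T}"
  define v where "v s = (if s \<le> T0 then v0 s else if a \<le> s then v1 (s - a) else 0)" for s
  have vU: "v s \<in> U" for s
    using v0(2) v1(2) U(2) by (simp add: v_def)
  have v: "v \<in> borel_measurable lebesgue"
  proof -
    have "(\<lambda>s. - a + 1 * s) \<in> lebesgue \<rightarrow>\<^sub>M lebesgue"
      using lebesgue_affine_measurable[where c = "\<lambda>s::real. 1" and t = "- a"] by simp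
    then have "(\<lambda>s. v1 (- a + 1 * s)) \<in> borel_measurable lebesgue"
      by (rule measurable_compose[OF _ v1(1)])
    then have "(\<lambda>s. v1 (s - a)) \<in> borel_measurable lebesgue"
      by simp
    moreover have "{s \<in> space lebesgue. s \<le> T0} = {..T0}" "{s \<in> space lebesgue. a \<le> s} = {a..}"
      by auto
    ultimately show ?thesis
      unfolding v_def by (intro measurable_If v0(1)) auto
  qed
  interpret f: forced_dissipative_semigroup S \<delta> V "\<lambda>s. B (v s)" K
    by (rule forced[OF v vU])
  interpret f1: forced_dissipative_semigroup S \<delta> V "\<lambda>s. B (v1 s)" K
    by (rule forced[OF v1(1,2)])
  have traj: "f.traj x0 = mild_solution S B x0 v"
    by (simp add: fun_eq_iff mild_solution_def f.traj_def)
  have K0: "0 \<le> K"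
    by (rule f.K_nonneg)
  have E: "E \<in> sets lebesgue" "emeasure lebesgue E < \<infinity>" "measure lebesgue E \<le> T0 + T1"
  proof -
    show "E \<in> sets lebesgue"
      by (simp add: E_def)
    have "emeasure lebesgue E \<le> emeasure lebesgue {0..T0} + emeasure lebesgue {a..T}"
      unfolding E_def by (rule emeasure_subadditive) auto
    also have "\<dots> < \<infinity>"
      by (simp add: emeasure_lborel_Icc_eq ennreal_plus[symmetric] del: ennreal_plus)
    finally show "emeasure lebesgue E < \<infinity>" .
    have "measure lebesgue E \<le> measure lebesgue {0..T0} + measure lebesgue {a..T}"
      unfolding E_def by (rule measure_Un_le) auto
    then show "measure lebesgue E \<le> T0 + T1"
      using u0(3) a by simp
  qed
  have B_v_le: "norm (B (v s)) \<le> K * indicator E s" if "s \<in> {0..T}" for s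
    using K[OF v0(2)[of s]] K[OF v1(2)[of "s - a"]] that
    by (auto simp: E_def v_def B_zero split: split_indicator)
  have traj_le: "norm (f.traj x0 t) \<le> norm x0 + K * (T0 + T1)" if t: "0 \<le> t" "t \<le> T" for t
  proof -
    have "norm (LINT s:{0..t}|lebesgue. S (t - s) (B (v s))) \<le> K * measure lebesgue E"
    proof (rule set_integral_norm_le_measure[OF E(1,2) K0], intro AE_I2 impI)
      fix s assume s: "s \<in> {0..t}"
      have "norm (S (t - s) (B (v s))) \<le> norm (B (v s))"
        using s by (intro contraction) simp
      also have "\<dots> \<le> K * indicator E s"
        using s t by (intro B_v_le) auto
      finally show "norm (S (t - s) (B (v s))) \<le> K * indicator E s" .
    qed
    also have "\<dots> \<le> K * (T0 + T1)"
      by (rule mult_left_mono[OF E(3) K0])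
    finally show ?thesis
      unfolding f.traj_def using contraction[OF t(1), of x0]
      by (intro norm_triangle_le add_mono)
  qed
  have at_T0: "f.traj x0 T0 = 0"
  proof -
    have "(LINT s:{0..T0}|lebesgue. S (T0 - s) (B (v s))) = (LINT s:{0..T0}|lebesgue. S (T0 - s) (B (v0 s)))"
      by (intro set_lebesgue_integral_cong) (auto simp: v_def)
    then show ?thesis
      using v0(3) by (simp add: f.traj_def mild_solution_def)
  qed
  have at_a: "f.traj x0 a = 0"
  proof -
    \<comment> \<open>During the rest phase the control can differ from zero only at the two
      endpoints, a null set.\<close>
    have "norm (LINT s:{T0..a}|lebesgue. S (a - s) (B (v s))) \<le> K * measure lebesgue {T0, a}"
    proof (rule set_integral_norm_le_measure[OF _ _ K0], goal_cases)
      case 3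
      show ?case
      proof (intro AE_I2 impI)
        fix s assume s: "s \<in> {T0..a}"
        show "norm (S (a - s) (B (v s))) \<le> K * indicator {T0, a} s"
          using f.S_f_le[of "a - s" s] s linear_simps(3)[OF linear[of "a - s"]]
          by (auto simp: v_def B_zero split: split_indicator)
      qed
    qed (auto simp: emeasure_lborel_countable)
    also have "measure lebesgue {T0, a} = 0"
      by (simp add: measure_def emeasure_lborel_countable)
    finally show ?thesis
      using f.traj_step[of T0 "a - T0" x0] u0(3) a at_T0 linear_simps(3)[OF linear[of "a - T0"]] by simp
  qed
  have at_T: "f.traj x0 T = xT"
  proof -
    \<comment> \<open>Shifting time by \<open>a\<close> turns the last leg into the original
      steering from 0 over a horizon of length \<open>T1\<close>.\<close>
    have "(LINT s:{a..a + T1}|lebesgue. S (a + T1 - s) (B (v s)))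
        = (LINT s:{a..a + T1}|lebesgue. S (T1 - (s - a)) (B (v1 (s - a))))"
      using a by (intro set_lebesgue_integral_cong) (auto simp: v_def algebra_simps)
    also have "\<dots> = (LINT s:{0..T1}|lebesgue. S (T1 - s) (B (v1 s)))"
      by (rule set_lebesgue_integral_shift) (intro convolution_measurable B_measurable v1(1) order_refl)
    finally have "f.traj x0 (a + T1) = (LINT s:{0..T1}|lebesgue. S (T1 - s) (B (v1 s)))"
      using f.traj_step[of a T1 x0] at_a a u0(3) u1(3) linear_simps(3)[OF linear[OF u1(3)]] by simp
    then show ?thesis
      using v1(3) a(3) linear_simps(3)[OF linear[OF u1(3)]] by (simp add: mild_solution_def)
  qed
  show thesis
  proof (rule that)
    show "v \<in> feasible_controls S B U xT T x0"
      using at_T admissible_control[OF v vU] by (simp add: feasible_controls_def traj)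
    let ?C = "K * (norm x0 + K * (T0 + T1))"
    have C: "0 \<le> ?C"
      using K0 u0(3) u1(3) by simp
    have "supplied_energy S B T x0 v = (LINT s:{0..T}|lebesgue. inner (B (v s)) (f.traj x0 s))"
      unfolding supplied_energy_def supply_eq traj ..
    also have "\<dots> \<le> norm (LINT s:{0..T}|lebesgue. inner (B (v s)) (f.traj x0 s))"
      by simp
    also have "\<dots> \<le> ?C * measure lebesgue E"
    proof (rule set_integral_norm_le_measure[OF E(1,2) C], intro AE_I2 impI)
      fix s assume s: "s \<in> {0..T}"
      have "norm (inner (B (v s)) (f.traj x0 s)) \<le> norm (B (v s)) * norm (f.traj x0 s)"
        using Cauchy_Schwarz_ineq2 by simp
      also have "\<dots> \<le> K * indicator E s * (norm x0 + K * (T0 + T1))"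
        using s K0 by (intro mult_mono B_v_le traj_le) auto
      finally show "norm (inner (B (v s)) (f.traj x0 s)) \<le> ?C * indicator E s"
        by (simp add: mult_ac)
    qed
    also have "\<dots> \<le> ?C * (T0 + T1)"
      by (rule mult_left_mono[OF E(3) C])
    finally show "supplied_energy S B T x0 v \<le> ?C * (T0 + T1)" .
  qed
qed

text \<open>Reachability at time 0 is defined without a control, so the zero control on the
  degenerate horizon is supplied for that case.\<close>

lemma reachable_from_0:
  assumes "xT \<in> reachable S B U 0"
  obtains T u where "0 \<le> T" "u \<in> admissible_controls U T" "mild_solution S B 0 u T = xT"
proof -
  obtain T where T: "0 \<le> T" "xT \<in> reachable_at S B U T 0"
    using assms by (auto simp: reachable_def)
  show thesis
  proof (cases "T = 0")
    case True
    have "(\<lambda>_. 0) \<in> admissible_controls U 0"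
      using U(2) by (intro admissible_control) auto
    moreover have "(LINT s:{0..0}|lebesgue. S (0 - s) (B 0)) = (LINT s:{0..0::real}|lebesgue. (0::'a))"
      using C0_semigroupD(2)[OF C0] by (intro set_lebesgue_integral_cong) (auto simp: B_zero)
    then have "mild_solution S B 0 (\<lambda>_. 0) 0 = 0"
      using C0_semigroupD(2)[OF C0] by (simp add: mild_solution_def)
    ultimately show ?thesis
      using that[of 0 "\<lambda>_. 0"] T True by (simp add: reachable_at_def)
  next
    case False
    then show ?thesis
      using that T by (auto simp: reachable_at_def)
  qed
qed

text \<open>\<open>\<tau>\<close> is the time needed for both steering legs, and \<open>F\<close> is
  the initial energy plus the cost bound of the comparison control, divided by the gap
  \<open>\<delta>\<close>. It depends on \<open>x0\<close> only through its norm, hence is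
  continuous.\<close>

theorem turnpike:
  assumes T0: "0 < T0" and xT: "xT \<in> reachable S B U 0"
  shows "state_integral_turnpike (optimal_pair S B U xT) {x0. 0 \<in> reachable_at S B U T0 x0} V"
proof -
  obtain T1 u1 where u1: "0 \<le> T1" "u1 \<in> admissible_controls U T1" "mild_solution S B 0 u1 T1 = xT"
    using reachable_from_0[OF xT] by blast
  let ?C = "\<lambda>x0::'a. K * (norm x0 + K * (T0 + T1)) * (T0 + T1)"
  define F where "F x0 = ((norm x0)\<^sup>2 / 2 + ?C x0) / \<delta>" for x0 :: 'a
  define \<tau> where "\<tau> x0 = T0 + T1" for x0 :: 'a
  have "norm (B 0) \<le> K"
    by (rule K[OF U(2)])
  then have "0 \<le> K"
    by (simp add: B_zero)
  then have F0: "0 \<le> F x0" for x0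
    using \<delta>_pos T0 u1(1) by (simp add: F_def)
  have contF: "continuous_on X F" for X
    unfolding F_def using \<delta>_pos by (intro continuous_intros) auto
  have cont\<tau>: "continuous_on X \<tau>" for X
    unfolding \<tau>_def by (intro continuous_intros)
  have \<tau>0: "0 \<le> \<tau> x0" for x0
    using T0 u1(1) by (simp add: \<tau>_def)
  have bound: "(LINT t:{0..T}|lebesgue. (infdist (x t) V)\<^sup>2) \<le> F x0"
    if x0: "0 \<in> reachable_at S B U T0 x0" and T: "\<tau> x0 < T"
      and opt: "optimal_pair S B U xT T x0 x u" for x0 T x u
  proof -
    obtain u0 where u0: "u0 \<in> admissible_controls U T0" "mild_solution S B x0 u0 T0 = 0"
      using x0 T0 by (auto simp: reachable_at_def)
    obtain v where v: "v \<in> feasible_controls S B U xT T x0" "supplied_energy S B T x0 v \<le> ?C x0"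
      using concatenation[OF u0 _ u1(2,3,1), of T] T0 T by (auto simp: \<tau>_def)
    have u: "u \<in> admissible_controls U T"
      and le: "supplied_energy S B T x0 u \<le> supplied_energy S B T x0 v"
      and x: "\<And>t. t \<in> {0..T} \<Longrightarrow> x t = mild_solution S B x0 u t"
      using opt v(1) by (auto simp: optimal_pair_def feasible_controls_def)
    have "(LINT t:{0..T}|lebesgue. (infdist (x t) V)\<^sup>2)
        = (LINT t:{0..T}|lebesgue. (infdist (mild_solution S B x0 u t) V)\<^sup>2)"
      by (intro set_lebesgue_integral_cong) (auto simp: x)
    then have "\<delta> * (LINT t:{0..T}|lebesgue. (infdist (x t) V)\<^sup>2) \<le> (norm x0)\<^sup>2 / 2 + ?C x0"
      using admissible_energy_inequality[OF u, of x0] T T0 u1(1) le v(2) by (simp add: \<tau>_def)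
    then show ?thesis
      using \<delta>_pos by (simp add: F_def pos_le_divide_eq mult.commute)
  qed
  show ?thesis
    unfolding state_integral_turnpike_def
    by (rule exI[of _ F], rule exI[of _ \<tau>]) (use F0 \<tau>0 contF cont\<tau> bound in auto)
qed

end

section \<open>Port-Hamiltonian operators\<close>

lemma port_Hamiltonian_domain_dense:
  assumes "skew_adjoint J" "self_adjoint R"
    and "relatively_bounded J R \<or> relatively_bounded R J"
  shows "densely_defined (op_diff J R)"
proof -
  have "dom (op_diff J R) = dom J \<inter> dom R"
    by (auto simp: op_diff_def dom_def split: if_splits)
  \<comment> \<open>Relative boundedness places one domain inside the other, so the intersection is
    a domain already known to be dense.\<close>
  then have "dom (op_diff J R) = dom R \<or> dom (op_diff J R) = dom J"
    using assms(3) by (auto simp: relatively_bounded_def)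
  then show ?thesis
    using assms(1,2) by (auto simp: densely_defined_def self_adjoint_def skew_adjoint_def)
qed

lemma port_Hamiltonian_dissipative:
  assumes J: "skew_adjoint J" and gap: "\<And>x. x \<in> dom R \<Longrightarrow> \<delta> * (infdist x V)\<^sup>2 \<le> inner (the (R x)) x"
    and y: "op_diff J R x = Some y"
  shows "inner y x \<le> - \<delta> * (infdist x V)\<^sup>2"
proof -
  have x: "x \<in> dom J" "x \<in> dom R" and y: "y = the (J x) - the (R x)"
    using y by (auto simp: op_diff_def split: if_splits)
  show ?thesis
    using skew_adjoint_inner_eq_0[OF J x(1)] gap[OF x(2)] by (simp add: y inner_diff_left)
qed

theorem theorem6:
  fixes J R :: "'h::{chilbert_space, second_countable_topology} \<rightharpoonup> 'h"
    and S :: "real \<Rightarrow> 'h \<Rightarrow> 'h"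
    and B :: "complex ^ 'm \<Rightarrow> 'h"
    and U :: "(complex ^ 'm) set"
    and T\<^sub>0 :: real
    and x\<^sub>T :: 'h
  assumes "skew_adjoint J"
    and "self_adjoint R" and "positive_semidefinite R"
    and "relatively_bounded J R \<and> relative_bound J R < 1 \<or>
         relatively_bounded R J \<and> relative_bound R J < 1"
    and "C0_semigroup S" and "generator S = op_diff J R"
    and "bounded_clinear B"
    and "compact U" and "convex U" and "0 \<in> interior U"
    and "0 \<in> discrete_spectrum R \<union> resolvent_set R"
    and "T\<^sub>0 > 0"
    and "x\<^sub>T \<in> reachable S B U 0"
  shows "state_integral_turnpike (optimal_pair S B U x\<^sub>T)
           {x\<^sub>0. 0 \<in> reachable_at S B U T\<^sub>0 x\<^sub>0} (op_kernel R)"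
proof -
  obtain \<delta> where \<delta>: "0 < \<delta>"
    and gap: "\<And>x. x \<in> dom R \<Longrightarrow> \<delta> * (infdist x (op_kernel R))\<^sup>2 \<le> inner (the (R x)) x"
    using spectral_gap[OF assms(2,3,11)] by blast
  have dense: "densely_defined (generator S)"
    unfolding assms(6) using assms(4) by (intro port_Hamiltonian_domain_dense assms(1,2)) blast
  have diss: "inner y x \<le> - \<delta> * (infdist x (op_kernel R))\<^sup>2" if "generator S x = Some y" for x y
    using port_Hamiltonian_dissipative[OF assms(1) gap] that by (simp add: assms(6))
  have "continuous_on U B"
    using assms(7) by (auto simp: bounded_clinear_def intro: linear_continuous_on)
  then have "bounded (B ` U)"
    using assms(8) by (intro compact_imp_bounded compact_continuous_image)
  then obtain K where K: "\<And>u. u \<in> U \<Longrightarrow> norm (B u) \<le> K"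
    by (auto simp: bounded_iff)
  interpret control_system S \<delta> "op_kernel R" B U K
  proof unfold_locales
    have nonpos: "inner y x \<le> 0" if "generator S x = Some y" for x y
    proof -
      have "0 \<le> \<delta> * (infdist x (op_kernel R))\<^sup>2"
        using \<delta> by simp
      with diss[OF that] show ?thesis
        by linarith
    qed
    show "norm (S t x) \<le> norm x" if "0 \<le> t" for t x
      by (rule dissipative_contraction[OF assms(5) dense nonpos that])
    show "(norm (S h x))\<^sup>2 / 2 + \<delta> * h * r\<^sup>2 \<le> (norm x)\<^sup>2 / 2"
      if "0 \<le> h" "0 \<le> r" "\<And>t. 0 \<le> t \<Longrightarrow> t \<le> h \<Longrightarrow> r \<le> infdist (S t x) (op_kernel R)" for h r x
      using energy_decay[OF assms(5) dense less_imp_le[OF \<delta>] diss that] .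
    show "0 \<in> U"
      using assms(10) interior_subset by blast
  qed (use assms \<delta> K in auto)
  show ?thesis
    by (rule turnpike[OF assms(12,13)])
qed

end
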